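(* Let $V$ be a finite set and let $\mathbf{X}_V=(X_v,\, v\in V)'$ be a random vector with multivariate Gaussian distribution $P$ on $\mathbb{R}^{|V|}$ with mean vector $\mu$ and symmetric positive definite covariance matrix $\Sigma=(\sigma_{uv})_{u,v\in V}$. Let $G_0=(V,E_0)$ be the covariance graph associated with $P$. If $G_0$ is a tree or, more generally, a union of connected components each of which is a tree, then $P$ is covariance faithful to $G_0$; that is, for all pairwise disjoint subsets $A$, $B$, $S$ of $V$, $S$ separates $A$ and $B$ in $G_0$ if and only if $\mathbf{X}_A$ and $\mathbf{X}_B$ are conditionally independent given $\mathbf{X}_{V\setminus(A\cup B\cup S)}$.
   Context: All graphs are finite, undirected and without loops. The covariance graph $G_0=(V,E_0)$ associated with $P$ has vertex set $V$, and for $u\neq v$ in $V$, $(u,v)\notin E_0$ if and only if $X_u$ and $X_v$ are (marginally) independent; for a Gaussian distribution this is equivalent to $\sigma_{uv}=0$. For $A\subseteq V$, $\mathbf{X}_A=(X_v,\, v\in A)'$; conditioning on $\mathbf{X}_\emptyset$ means no conditioning. A path connecting two distinct vertices $u$ and $v$ is a sequence of distinct vertices $(u_0,\ldots,u_n)$ with $u_0=u$, $u_n=v$ and $u_i$ adjacent to $u_{i+1}$ for $i=0,\ldots,n-1$. A graph is a tree if any two distinct vertices are connected by exactly one path. For pairwise disjoint subsets $A,B,S$ of $V$ (where $S$ may be empty), $S$ separates $A$ and $B$ if for every $(u,v)\in A\times B$, every path connecting $u$ and $v$ intersects $S$ (in particular this holds if there is no path connecting $u$ and $v$). *)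

theory Defs
  imports "HOL-Probability.Probability"
begin

definition positive_definite :: "real ^ 'v ^ 'v \<Rightarrow> bool" where
  "positive_definite S \<longleftrightarrow> (\<forall>x. x \<noteq> 0 \<longrightarrow> x \<bullet> (S *v x) > 0)"

definition mv_normal_density :: "real ^ 'v \<Rightarrow> real ^ 'v ^ 'v \<Rightarrow> real ^ 'v \<Rightarrow> real" where
  "mv_normal_density \<mu> S x =
     exp (- ((x - \<mu>) \<bullet> (matrix_inv S *v (x - \<mu>))) / 2) / sqrt ((2 * pi) ^ CARD('v) * det S)"

definition subvector :: "('a \<Rightarrow> real ^ 'v) \<Rightarrow> 'v set \<Rightarrow> 'a \<Rightarrow> 'v \<Rightarrow> real" where
  "subvector X A \<omega> = (\<lambda>v\<in>A. X \<omega> $ v)"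

definition cond_indep_var ::
    "'a measure \<Rightarrow> 'b measure \<Rightarrow> ('a \<Rightarrow> 'b) \<Rightarrow> 'c measure \<Rightarrow> ('a \<Rightarrow> 'c)
      \<Rightarrow> 'd measure \<Rightarrow> ('a \<Rightarrow> 'd) \<Rightarrow> bool" where
  "cond_indep_var M MX X MY Y MZ Z \<longleftrightarrow>
     X \<in> measurable M MX \<and> Y \<in> measurable M MY \<and> Z \<in> measurable M MZ \<and>
     (let F = vimage_algebra (space M) Z MZ in
      \<forall>K\<in>sets MX. \<forall>L\<in>sets MY. AE \<omega> in M.
        real_cond_exp M F (indicator ((X -` K \<inter> space M) \<inter> (Y -` L \<inter> space M))) \<omega> =
        real_cond_exp M F (indicator (X -` K \<inter> space M)) \<omega> *
        real_cond_exp M F (indicator (Y -` L \<inter> space M)) \<omega>)"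

text \<open>
  For \<open>C = {}\<close> the subvector indexed by \<open>C\<close> is constant, so it generates the trivial sigma-algebra
  and conditioning on it is no conditioning at all.
\<close>

definition cond_indep_subvectors ::
    "'a measure \<Rightarrow> ('a \<Rightarrow> real ^ 'v) \<Rightarrow> 'v set \<Rightarrow> 'v set \<Rightarrow> 'v set \<Rightarrow> bool" where
  "cond_indep_subvectors M X A B C \<longleftrightarrow>
     cond_indep_var M (\<Pi>\<^sub>M v\<in>A. borel) (subvector X A)
                      (\<Pi>\<^sub>M v\<in>B. borel) (subvector X B)
                      (\<Pi>\<^sub>M v\<in>C. borel) (subvector X C)"

text \<open>
  A graph is given by its vertex set \<open>W\<close> and an edge relation \<open>E\<close>; edges leaving \<open>W\<close> are ignored,
  so the same \<open>E\<close> with a smaller \<open>W\<close> represents the induced subgraph.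
  The list \<open>[u]\<close> is a path from \<open>u\<close> to itself, so each vertex lies in its own component.
\<close>

definition path_between :: "'v set \<Rightarrow> 'v rel \<Rightarrow> 'v \<Rightarrow> 'v \<Rightarrow> 'v list \<Rightarrow> bool" where
  "path_between W E u v p \<longleftrightarrow>
     p \<noteq> [] \<and> hd p = u \<and> last p = v \<and> distinct p \<and> set p \<subseteq> W \<and>
     successively (\<lambda>x y. (x, y) \<in> E) p"

definition is_tree :: "'v set \<Rightarrow> 'v rel \<Rightarrow> bool" where
  "is_tree W E \<longleftrightarrow> (\<forall>u\<in>W. \<forall>v\<in>W. u \<noteq> v \<longrightarrow> (\<exists>!p. path_between W E u v p))"

definition graph_components :: "'v set \<Rightarrow> 'v rel \<Rightarrow> 'v set set" where
  "graph_components W E = (\<lambda>u. {v \<in> W. \<exists>p. path_between W E u v p}) ` W"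

definition is_union_of_trees :: "'v set \<Rightarrow> 'v rel \<Rightarrow> bool" where
  "is_union_of_trees W E \<longleftrightarrow> (\<forall>C\<in>graph_components W E. is_tree C E)"

definition separates :: "'v set \<Rightarrow> 'v rel \<Rightarrow> 'v set \<Rightarrow> 'v set \<Rightarrow> 'v set \<Rightarrow> bool" where
  "separates W E S A B \<longleftrightarrow>
     (\<forall>u\<in>A. \<forall>v\<in>B. \<forall>p. path_between W E u v p \<longrightarrow> set p \<inter> S \<noteq> {})"

definition covariance_graph :: "'a measure \<Rightarrow> ('a \<Rightarrow> real ^ 'v) \<Rightarrow> 'v rel" where
  "covariance_graph M X =
     {(u, v). u \<noteq> v \<and>
        \<not> prob_space.indep_var M borel (\<lambda>\<omega>. X \<omega> $ u) borel (\<lambda>\<omega>. X \<omega> $ v)}"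

definition covariance_faithful :: "'a measure \<Rightarrow> ('a \<Rightarrow> real ^ 'v) \<Rightarrow> 'v rel \<Rightarrow> bool" where
  "covariance_faithful M X E \<longleftrightarrow>
     (\<forall>A B S. disjnt A B \<and> disjnt A S \<and> disjnt B S \<longrightarrow>
        (separates UNIV E S A B \<longleftrightarrow> cond_indep_subvectors M X A B (UNIV - (A \<union> B \<union> S))))"

end

theory Submission
  imports Defs
begin

text \<open>
  Write \<open>\<langle>x, y\<rangle>\<close> for \<open>x \<bullet> (\<Sigma> *v y)\<close>, the covariance of the linear functionals \<open>x \<bullet> X\<close> and \<open>y \<bullet> X\<close>;
  because \<open>\<Sigma>\<close> is positive definite this is an inner product. The covariance graph has an edge
  exactly where \<open>\<Sigma>\<close> has a nonzero off-diagonal entry. Put \<open>C = V - (A \<union> B \<union> S)\<close>, the set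
  conditioned on.

  Separation implies conditional independence in every graph. Deleting \<open>S\<close> leaves the vertices that
  \<open>A\<close> can reach and the vertices that it cannot; \<open>B\<close> lies among the latter, and no edge joins the two
  sides (\<open>separates_cut\<close>). The coordinates on the two sides are therefore uncorrelated, hence
  independent, and \<open>C\<close> splits into a part on either side. If \<open>(X\<^sub>A, X\<^sub>C\<^sub>1)\<close> is independent of
  \<open>(X\<^sub>B, X\<^sub>C\<^sub>2)\<close>, then \<open>X\<^sub>A\<close> and \<open>X\<^sub>B\<close> are independent given \<open>(X\<^sub>C\<^sub>1, X\<^sub>C\<^sub>2)\<close>
  (\<open>cond_indep_of_indep\<close>).

  The converse uses the forest. If \<open>S\<close> does not separate, some path joins \<open>u \<in> A\<close> to \<open>v \<in> B\<close> with all
  inner vertices in \<open>C\<close> (\<open>not_separates_connecting_path\<close>). Let \<open>y \<bullet> X\<close> be the residual of the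
  regression of \<open>X\<^sub>v\<close> on \<open>X\<^sub>C\<close>: the vector \<open>y\<close> is supported on \<open>C \<union> {v}\<close>, has \<open>y\<^sub>v = 1\<close>, and \<open>\<Sigma> *v y\<close>
  vanishes on \<open>C\<close>. The residual is independent of \<open>X\<^sub>C\<close>, so conditional independence makes it
  uncorrelated with \<open>X\<^sub>u\<close>, that is, \<open>\<Sigma> *v y\<close> vanishes at \<open>u\<close> too
  (\<open>cond_indep_imp_orthogonal_residual\<close>). Now \<open>y\<^sub>u = 0\<close>, and this zero travels along the path: if
  \<open>(a, b)\<close> is the next edge and \<open>y\<^sub>a = 0\<close>, cut the tree at that edge and let \<open>z\<close> be the restriction of
  \<open>y\<close> to the side of \<open>a\<close>. As \<open>(a, b)\<close> is the only edge leaving that side, \<open>\<langle>z, z\<rangle>\<close> is a multiple of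
  \<open>y\<^sub>a\<close>, hence \<open>0\<close>; so \<open>z = 0\<close>, and reading \<open>\<Sigma> *v y\<close> at \<open>a\<close> gives \<open>\<Sigma>\<^sub>a\<^sub>b y\<^sub>b = 0\<close>
  (\<open>tree_path_step\<close>). At the end of the path \<open>y\<^sub>v = 0\<close>, contradicting \<open>y\<^sub>v = 1\<close>. This replaces the
  classical computation of a partial covariance as a product of edge covariances along the path, and
  no inverse or determinant of a submatrix appears.

  The probabilistic input is that uncorrelated linear functionals of \<open>X\<close> are independent
  (\<open>uncorrelated_families_indep\<close>). For this, a basis adapted to the two families and orthonormal for
  \<open>\<langle>x, y\<rangle>\<close> turns \<open>X - \<mu>\<close> into independent standard normal coordinates, of which the two families use
  disjoint sets.
\<close>

section \<open>Paths and separation in a forest\<close>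

text \<open>
  The form in which the forest hypothesis enters: it holds for a single tree and for a disjoint union of
  trees alike.
\<close>

definition unique_paths :: "'v rel \<Rightarrow> bool" where
  "unique_paths E \<longleftrightarrow> (\<forall>u v p q. path_between UNIV E u v p \<longrightarrow> path_between UNIV E u v q \<longrightarrow> p = q)"

lemma path_between_append_edge:
  assumes "path_between W E u a p" "(a, b) \<in> E" "b \<in> W" "b \<notin> set p"
  shows "path_between W E u b (p @ [b])"
  using assms by (auto simp: path_between_def successively_append_iff)

lemma path_between_prefix:
  assumes "path_between W E u v (xs @ w # ys)"
  shows "path_between W E u w (xs @ [w])"
  using assms by (auto simp: path_between_def successively_append_iff hd_append split: if_splits)

lemma path_between_suffix:
  assumes "path_between W E u v (xs @ w # ys)"
  shows "path_between W E w v (w # ys)"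
  using assms by (auto simp: path_between_def successively_append_iff)

lemma path_between_loop:
  assumes "path_between W E u u p"
  shows "p = [u]"
proof (cases p)
  case Nil
  then show ?thesis using assms by (simp add: path_between_def)
next
  case (Cons x xs)
  then show ?thesis using assms last_in_set[of xs]
    by (auto simp: path_between_def split: if_splits)
qed

text \<open>
  If \<open>b\<close> is already on the path, appending it would repeat a vertex; the initial part of the path
  up to \<open>b\<close> serves instead.
\<close>

lemma path_between_extend_avoiding:
  assumes p: "path_between UNIV E u a p" "set p \<inter> S = {}" and "(a, b) \<in> E" "b \<notin> S"
  shows "\<exists>q. path_between UNIV E u b q \<and> set q \<inter> S = {}"
proof (cases "b \<in> set p")
  case True
  then obtain xs ys where "p = xs @ b # ys" by (meson split_list)
  then have "path_between UNIV E u b (xs @ [b])" "set (xs @ [b]) \<inter> S = {}"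
    using p path_between_prefix[of UNIV E u a xs b ys] by auto
  then show ?thesis by blast
next
  case False
  then have "path_between UNIV E u b (p @ [b])" "set (p @ [b]) \<inter> S = {}"
    using assms path_between_append_edge[OF p(1)] by auto
  then show ?thesis by blast
qed

text \<open>
  In a union of trees, every vertex of a path from \<open>u\<close> is reached by an initial part of it and so lies
  in the component of \<open>u\<close>; both paths are paths of that tree.
\<close>

lemma forest_unique_paths:
  assumes "is_tree UNIV E \<or> is_union_of_trees UNIV E"
  shows "unique_paths E"
  unfolding unique_paths_def
proof (intro allI impI)
  fix u v p q
  assume p: "path_between UNIV E u v p" and q: "path_between UNIV E u v q"
  show "p = q"
  proof (cases "u = v")
    case True
    then show ?thesis using p q path_between_loop by metis
  next
    case neq: False
    \<comment> \<open>The component of the common starting point.\<close>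
    define C where "C = {w. \<exists>r. path_between UNIV E u w r}"
    have mem: "set r \<subseteq> C" if r: "path_between UNIV E u v r" for r
    proof
      fix w assume "w \<in> set r"
      then obtain xs ys where "r = xs @ w # ys" by (meson split_list)
      then show "w \<in> C" using r path_between_prefix[of UNIV E u v xs w ys] by (auto simp: C_def)
    qed
    have inC: "path_between C E u v r" if r: "path_between UNIV E u v r" for r
      using r mem[OF r] by (auto simp: path_between_def)
    have uv: "u \<in> C" "v \<in> C"
      using inC[OF p] by (auto simp: path_between_def)
    from assms consider "is_tree UNIV E" | "is_tree C E"
      by (auto simp: is_union_of_trees_def graph_components_def C_def)
    then show ?thesis
    proof cases
      case 1
      then show ?thesis using neq p q unfolding is_tree_def by auto
    next
      case 2
      then show ?thesis using neq uv inC[OF p] inC[OF q] unfolding is_tree_def by blast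
    qed
  qed
qed

text \<open>
  \<open>A'\<close> consists of the vertices that can be reached from \<open>A\<close> off \<open>S\<close>. An edge from \<open>A'\<close> to a vertex
  outside \<open>A' \<union> S\<close> would make that vertex reachable.
\<close>

lemma separates_cut:
  assumes sep: "separates UNIV E S A B" and "disjnt A S" "disjnt B S"
  obtains A' B' where "A \<subseteq> A'" "B \<subseteq> B'" "A' \<union> B' = - S" "A' \<inter> B' = {}"
    "\<And>a b. a \<in> A' \<Longrightarrow> b \<in> B' \<Longrightarrow> (a, b) \<notin> E"
proof -
  define A' where "A' = {w. \<exists>u\<in>A. \<exists>p. path_between UNIV E u w p \<and> set p \<inter> S = {}}"
  have "A \<subseteq> A'"
  proof
    fix u assume "u \<in> A"
    moreover have "path_between UNIV E u u [u]" by (simp add: path_between_def)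
    ultimately show "u \<in> A'" using assms(2) unfolding A'_def disjnt_def by fastforce
  qed
  moreover have A'S: "A' \<inter> S = {}"
    unfolding A'_def path_between_def using last_in_set by fastforce
  moreover have "B \<subseteq> - S - A'"
    using sep assms(3) unfolding A'_def separates_def disjnt_def by blast
  moreover have "(a, b) \<notin> E" if "a \<in> A'" "b \<in> - S - A'" for a b
    using that path_between_extend_avoiding[of E _ a _ S b] unfolding A'_def by blast
  ultimately show ?thesis
    by (intro that[of A' "- S - A'"]) auto
qed

text \<open>
  Among all paths that join \<open>A\<close> to \<open>B\<close> off \<open>S\<close>, a shortest one meets \<open>A \<union> B\<close> at its ends only, since
  an inner vertex in \<open>A\<close> or \<open>B\<close> would allow it to be shortened.
\<close>

lemma not_separates_connecting_path:
  assumes "\<not> separates UNIV E S A B" and "disjnt A B"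
  obtains u v p where "u \<in> A" "v \<in> B" "path_between UNIV E u v p" 
    "set p \<subseteq> insert u (insert v (- (A \<union> B \<union> S)))"
proof -
  define P where "P = (\<lambda>(u, v, p). u \<in> A \<and> v \<in> B \<and> path_between UNIV E u v p \<and> set p \<inter> S = {})"
  have "\<exists>t. P t" using assms(1) unfolding separates_def P_def by auto
  then obtain t where t: "P t" and min: "\<And>s. P s \<Longrightarrow> length (snd (snd t)) \<le> length (snd (snd s))"
    using ex_has_least_nat[of P _ "\<lambda>t. length (snd (snd t))"] by blast
  obtain u v p where tup: "t = (u, v, p)" by (cases t)
  have p: "u \<in> A" "v \<in> B" "path_between UNIV E u v p" "set p \<inter> S = {}"
    using t unfolding P_def tup by auto
  have "w \<notin> A \<union> B" if w: "w \<in> set p" "w \<noteq> u" "w \<noteq> v" for w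
  proof
    assume "w \<in> A \<union> B"
    obtain xs ys where p_eq: "p = xs @ w # ys" using w by (meson split_list)
    have "xs \<noteq> []" "ys \<noteq> []" using p(3) w unfolding p_eq path_between_def by auto
    from \<open>w \<in> A \<union> B\<close> show False
    proof
      assume "w \<in> A"
      then have "P (w, v, w # ys)"
        using p path_between_suffix[of UNIV E u v xs w ys] unfolding P_def p_eq by auto
      from min[OF this] show False using \<open>xs \<noteq> []\<close> by (simp add: tup p_eq)
    next
      assume "w \<in> B"
      then have "P (u, w, xs @ [w])"
        using p path_between_prefix[of UNIV E u v xs w ys] unfolding P_def p_eq by auto
      from min[OF this] show False using \<open>ys \<noteq> []\<close> by (simp add: tup p_eq)
    qed
  qed
  then show ?thesis using p by (intro that[of u v p]) auto
qed

section \<open>The inner product of a positive definite matrix\<close>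

definition cov_form :: "real ^ 'v ^ 'v \<Rightarrow> real ^ 'v \<Rightarrow> real ^ 'v \<Rightarrow> real" where
  "cov_form S x y = x \<bullet> (S *v y)"

lemma cov_form_axis: "cov_form S (axis i 1) y = (S *v y) $ i"
  by (simp add: cov_form_def inner_axis')

lemma cov_form_axis_axis: "cov_form S (axis i 1) (axis j 1) = S $ i $ j"
  by (simp add: cov_form_axis matrix_vector_mul_component inner_axis)

lemma cov_form_linear_right: "linear (cov_form S x)"
  unfolding cov_form_def
  by (rule linearI) (simp_all add: matrix_vector_right_distrib inner_add_right matrix_vector_mult_scaleR)

lemma cov_form_linear_left: "linear (\<lambda>x. cov_form S x y)"
  unfolding cov_form_def
  by (rule linearI) (simp_all add: inner_add_left)

locale covariance_matrix =
  fixes \<Sigma> :: "real ^ 'v ^ 'v"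
  assumes symmetric: "transpose \<Sigma> = \<Sigma>"
    and positive: "positive_definite \<Sigma>"
begin

abbreviation cov :: "real ^ 'v \<Rightarrow> real ^ 'v \<Rightarrow> real" where
  "cov \<equiv> cov_form \<Sigma>"

lemma cov_commute: "cov x y = cov y x"
  unfolding cov_form_def by (metis dot_lmul_matrix inner_commute symmetric transpose_matrix_vector)

lemma cov_eq_0_iff: "cov x x = 0 \<longleftrightarrow> x = 0"
  using positive unfolding positive_definite_def cov_form_def by fastforce

lemma cov_pos: "x \<noteq> 0 \<Longrightarrow> cov x x > 0"
  using positive unfolding positive_definite_def cov_form_def by fastforce

lemmas cov_simps =
  linear_add[OF cov_form_linear_right] linear_add[OF cov_form_linear_left]
  linear_diff[OF cov_form_linear_right] linear_diff[OF cov_form_linear_left]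
  linear_0[OF cov_form_linear_right] linear_0[OF cov_form_linear_left]
  linear_scale[OF cov_form_linear_right] linear_scale[OF cov_form_linear_left]
  linear_sum[OF cov_form_linear_right] linear_sum[OF cov_form_linear_left]

definition orthonormal :: "(real ^ 'v) set \<Rightarrow> bool" where
  "orthonormal B \<longleftrightarrow> finite B \<and> (\<forall>x\<in>B. \<forall>y\<in>B. cov x y = (if x = y then 1 else 0))"

text \<open>
  The component of \<open>x\<close> orthogonal to the span of an orthonormal \<open>B\<close>.
\<close>

definition residual :: "(real ^ 'v) set \<Rightarrow> real ^ 'v \<Rightarrow> real ^ 'v" where
  "residual B x = x - (\<Sum>b\<in>B. cov b x *\<^sub>R b)"

lemma cov_orthonormal_sum:
  assumes "orthonormal B" "b \<in> B"
  shows "cov b (\<Sum>c\<in>B. f c *\<^sub>R c) = f b"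
proof -
  have "cov b (\<Sum>c\<in>B. f c *\<^sub>R c) = (\<Sum>c\<in>B. if c = b then f b else 0)"
    using assms unfolding cov_simps orthonormal_def by (intro sum.cong) auto
  then show ?thesis using assms by (simp add: orthonormal_def)
qed

lemma cov_residual:
  assumes "orthonormal B" "b \<in> B"
  shows "cov b (residual B x) = 0"
  using cov_orthonormal_sum[OF assms] by (simp add: residual_def cov_simps)

lemma cov_span_eq_0:
  assumes "\<And>b. b \<in> B \<Longrightarrow> cov b x = 0" "y \<in> span B"
  shows "cov y x = 0"
  using assms(2) by (induction rule: span_induct) (auto simp: assms(1) cov_simps subspace_def)

lemma orthonormal_independent:
  assumes "orthonormal B"
  shows "independent B"
proof -
  have "f b = 0" if "(\<Sum>c\<in>B. f c *\<^sub>R c) = 0" "b \<in> B" for f b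
    using cov_orthonormal_sum[OF assms that(2), of f] that(1) by (simp add: cov_simps)
  then show ?thesis
    using assms by (auto simp: orthonormal_def dependent_finite)
qed

lemma orthonormal_expansion:
  assumes B: "orthonormal B" and x: "x \<in> span B"
  shows "x = (\<Sum>b\<in>B. cov b x *\<^sub>R b)"
proof -
  obtain f where f: "x = (\<Sum>c\<in>B. f c *\<^sub>R c)"
    using B x by (auto simp: orthonormal_def span_finite)
  then show ?thesis
    using cov_orthonormal_sum[OF B] by (metis (no_types, lifting) sum.cong)
qed

text \<open>
  Gram--Schmidt in the form of a maximality argument: orthonormal sets are independent, so their size
  is bounded by the dimension, and one of maximal size spans \<open>U\<close>, because a vector of \<open>U\<close> outside the
  span would contribute its normalized residual.
\<close>

lemma orthonormal_extend:
  assumes U: "subspace U" and B0: "orthonormal B0" "B0 \<subseteq> U"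
  obtains B where "B0 \<subseteq> B" "orthonormal B" "B \<subseteq> U" "span B = U"
proof -
  define P where "P = (\<lambda>B. B0 \<subseteq> B \<and> orthonormal B \<and> B \<subseteq> U)"
  have "card B \<le> CARD('v)" if "P B" for B
    using that orthonormal_independent[of B] independent_card_le[of B] by (simp add: P_def)
  then obtain B where B: "P B" and max: "\<And>B'. P B' \<Longrightarrow> card B' \<le> card B"
    using ex_has_greatest_nat[of P B0 card "CARD('v) + 1"] B0 by (auto simp: P_def less_Suc_eq_le)
  have orth: "orthonormal B" and BU: "B \<subseteq> U" using B by (auto simp: P_def)
  have "U \<subseteq> span B"
  proof
    fix x assume x: "x \<in> U"
    show "x \<in> span B"
    proof (rule ccontr)
      assume nx: "x \<notin> span B"
      define r where "r = residual B x"
      have proj: "(\<Sum>b\<in>B. cov b x *\<^sub>R b) \<in> span B"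
        by (intro span_sum span_scale span_base)
      have "r \<noteq> 0" using nx proj unfolding r_def residual_def by auto
      then have pos: "cov r r > 0" by (rule cov_pos)
      define e where "e = (1 / sqrt (cov r r)) *\<^sub>R r"
      have "r \<in> U"
        unfolding r_def residual_def using U x BU
        by (intro subspace_diff subspace_sum subspace_scale) auto
      then have "e \<in> U" unfolding e_def using U by (intro subspace_scale)
      have ee: "cov e e = 1" using pos by (simp add: e_def cov_simps)
      have be: "cov b e = 0" if "b \<in> B" for b
        using cov_residual[OF orth that] by (simp add: e_def r_def cov_simps)
      have eb: "cov e b = 0" if "b \<in> B" for b
        using be[OF that] by (simp add: cov_commute)
      have "e \<notin> B" using be ee by auto
      have "P (insert e B)"
        using B \<open>e \<in> U\<close> ee be eb \<open>e \<notin> B\<close> unfolding P_def orthonormal_def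
        by auto
      from max[OF this] show False
        using \<open>e \<notin> B\<close> orth by (simp add: orthonormal_def)
    qed
  qed
  then have "span B = U" using U BU by (simp add: span_minimal subset_antisym)
  then show ?thesis using B that[of B] by (simp add: P_def)
qed

text \<open>
  The coefficient vector of the regression residual of the coordinate \<open>v\<close> on the coordinates \<open>C\<close>.
\<close>

lemma residual_on_coordinates:
  assumes "v \<notin> C"
  obtains y where "y $ v = 1" "\<And>w. w \<notin> insert v C \<Longrightarrow> y $ w = 0"
    "\<And>c. c \<in> C \<Longrightarrow> cov (axis c 1) y = 0"
proof -
  define U where "U = span ((\<lambda>c. axis c (1::real)) ` C)"
  obtain B where B: "orthonormal B" "B \<subseteq> U" "span B = U"
    using orthonormal_extend[of U "{}"] by (auto simp: U_def orthonormal_def)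
  define y where "y = residual B (axis v 1)"
  have U0: "x $ w = 0" if "x \<in> U" "w \<notin> C" for x w
    using that(1) unfolding U_def
  proof (induction rule: span_induct)
    case base
    then show ?case by (auto simp: subspace_def)
  next
    case (step x)
    then show ?case using that(2) by (auto simp: axis_def)
  qed
  have "(\<Sum>b\<in>B. cov b (axis v 1) *\<^sub>R b) \<in> U"
    using B(2) by (auto simp: U_def intro!: span_sum span_scale)
  then have y0: "y $ w = axis v 1 $ w" if "w \<notin> C" for w
    using U0[OF _ that] by (simp add: y_def residual_def del: sum_component)
  show ?thesis
  proof
    show "y $ v = 1" using y0 assms by simp
    show "y $ w = 0" if "w \<notin> insert v C" for w using y0 that by (simp add: axis_def)
    show "cov (axis c 1) y = 0" if "c \<in> C" for c
      using cov_span_eq_0[of B y] cov_residual[OF B(1)] B(3) that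
      by (auto simp: y_def U_def span_base)
  qed
qed

end

section \<open>Vectors orthogonal along a path of a tree\<close>

context covariance_matrix
begin

text \<open>
  Let \<open>T\<close> be the side of \<open>a\<close> when the edge \<open>(a, b)\<close> is cut. By uniqueness of paths, \<open>(a, b)\<close> is the
  only edge that leaves \<open>T\<close>, and \<open>v\<close> is not in \<open>T\<close>. For the restriction \<open>z\<close> of \<open>y\<close> to \<open>T\<close> and for \<open>t \<noteq> a\<close>
  in \<open>T\<close> the vectors \<open>\<Sigma> *v z\<close> and \<open>\<Sigma> *v y\<close> therefore agree at \<open>t\<close>, where the latter is \<open>0\<close> unless
  \<open>y\<^sub>t = 0\<close>. So each product \<open>z\<^sub>t (\<Sigma> *v z)\<^sub>t\<close> is \<open>0\<close> (for \<open>t = a\<close> because \<open>y\<^sub>a = 0\<close>), and \<open>z = 0\<close> by positive definiteness. What remains of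
  \<open>\<Sigma> *v y\<close> at \<open>a\<close> is the contribution of \<open>b\<close>.
\<close>

lemma tree_path_step:
  assumes E: "E = {(u, v). u \<noteq> v \<and> \<Sigma> $ u $ v \<noteq> 0}" and uniq: "unique_paths E"
    and p: "path_between UNIV E a v (a # b # ps)"
    and supp: "\<And>w. w \<noteq> a \<Longrightarrow> w \<noteq> v \<Longrightarrow> y $ w \<noteq> 0 \<Longrightarrow> cov (axis w 1) y = 0"
    and a: "cov (axis a 1) y = 0" "y $ a = 0"
  shows "y $ b = 0"
proof -
  define T where "T = {w. \<exists>q. path_between UNIV E a w q \<and> set q \<inter> {b} = {}}"
  have edge: "(a, b) \<in> E" and "a \<noteq> b" using p by (auto simp: path_between_def)
  have "v \<notin> T" using uniq p unfolding T_def unique_paths_def by fastforce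
  have "b \<notin> T" unfolding T_def path_between_def using last_in_set by fastforce
  have "path_between UNIV E a a [a]" by (simp add: path_between_def)
  then have "a \<in> T" using \<open>a \<noteq> b\<close> unfolding T_def by fastforce
  have ab: "path_between UNIV E a b [a, b]" using edge \<open>a \<noteq> b\<close> by (simp add: path_between_def)
  have boundary: "t = a \<and> s = b" if ts: "t \<in> T" "s \<notin> T" "\<Sigma> $ t $ s \<noteq> 0" for t s
  proof -
    have "(t, s) \<in> E" using ts by (auto simp: E)
    obtain q where q: "path_between UNIV E a t q" "set q \<inter> {b} = {}"
      using ts(1) unfolding T_def by blast
    have "s = b"
      using path_between_extend_avoiding[OF q \<open>(t, s) \<in> E\<close>] ts(2) unfolding T_def by auto
    moreover from this have "path_between UNIV E a b (q @ [b])"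
      using path_between_append_edge[OF q(1) \<open>(t, s) \<in> E\<close>] q(2) by simp
    then have "q @ [b] = [a, b]" using uniq ab unfolding unique_paths_def by blast
    then have "t = a" using q(1) by (auto simp: path_between_def)
    ultimately show ?thesis by blast
  qed
  define z where "z = (\<chi> w. if w \<in> T then y $ w else 0)"
  have split: "cov (axis t 1) y = cov (axis t 1) z + (\<Sum>s\<in>-T. \<Sigma> $ t $ s * y $ s)" for t
  proof -
    have "cov (axis t 1) y = (\<Sum>s\<in>UNIV. \<Sigma> $ t $ s * y $ s)"
      by (simp add: cov_form_axis matrix_vector_mult_def)
    also have "\<dots> = (\<Sum>s\<in>T. \<Sigma> $ t $ s * y $ s) + (\<Sum>s\<in>-T. \<Sigma> $ t $ s * y $ s)"
      by (subst sum.union_disjoint[symmetric]) (auto intro!: sum.cong)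
    also have "(\<Sum>s\<in>T. \<Sigma> $ t $ s * y $ s) = (\<Sum>s\<in>UNIV. \<Sigma> $ t $ s * z $ s)"
      by (rule sum.mono_neutral_cong_left) (auto simp: z_def)
    also have "\<dots> = cov (axis t 1) z"
      by (simp add: cov_form_axis matrix_vector_mult_def)
    finally show ?thesis .
  qed
  have zero: "z $ t * cov (axis t 1) z = 0" for t
  proof (cases "t \<in> T \<and> t \<noteq> a \<and> y $ t \<noteq> 0")
    case True
    then have "(\<Sum>s\<in>-T. \<Sigma> $ t $ s * y $ s) = 0"
      using boundary by (intro sum.neutral) auto
    moreover have "cov (axis t 1) y = 0"
      using supp True \<open>v \<notin> T\<close> by blast
    ultimately show ?thesis using split[of t] by simp
  next
    case False
    then show ?thesis using a(2) by (auto simp: z_def)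
  qed
  have "cov z z = (\<Sum>t\<in>UNIV. z $ t * cov (axis t 1) z)"
    unfolding cov_form_axis by (simp add: cov_form_def inner_vec_def)
  then have "cov z z = 0" using zero by simp
  then have "z = 0" by (simp add: cov_eq_0_iff)
  then have "0 = (\<Sum>s\<in>-T. \<Sigma> $ a $ s * y $ s)"
    using split[of a] a(1) by (simp add: cov_simps)
  also have "\<dots> = (\<Sum>s\<in>{b}. \<Sigma> $ a $ s * y $ s)"
    using \<open>b \<notin> T\<close> boundary[OF \<open>a \<in> T\<close>] by (intro sum.mono_neutral_right) auto
  finally show ?thesis using edge by (simp add: E)
qed

lemma tree_path_vanish:
  assumes E: "E = {(u, v). u \<noteq> v \<and> \<Sigma> $ u $ v \<noteq> 0}" and uniq: "unique_paths E"
    and p: "path_between UNIV E u v p"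
    and supp: "\<And>w. w \<noteq> v \<Longrightarrow> y $ w \<noteq> 0 \<Longrightarrow> cov (axis w 1) y = 0"
    and orth: "\<And>w. w \<in> set p \<Longrightarrow> w \<noteq> v \<Longrightarrow> cov (axis w 1) y = 0"
    and u: "y $ u = 0"
  shows "y $ v = 0"
  using p orth u
proof (induction p arbitrary: u rule: induct_list012)
  case 1
  then show ?case by (simp add: path_between_def)
next
  case (2 x)
  then show ?case by (auto simp: path_between_def)
next
  case (3 x b ps)
  have "v = last (b # ps)" using 3(3) by (simp add: path_between_def)
  then have "v \<in> set (b # ps)" by (metis last_in_set list.distinct(1))
  then have "x = u" "u \<noteq> v" using 3(3) by (auto simp: path_between_def)
  have "y $ b = 0"
    using 3(3-5) \<open>x = u\<close> \<open>u \<noteq> v\<close>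
    by (intro tree_path_step[OF E uniq, of u v b ps y]) (auto simp: supp)
  moreover have "path_between UNIV E b v (b # ps)"
    using path_between_suffix[of UNIV E u v "[x]" b ps] 3(3) by simp
  ultimately show ?case using 3(2)[of b] 3(4) by auto
qed

end

section \<open>Independent and conditionally independent sigma-algebras\<close>

lemma Int_stable_Int_pairs: "Int_stable {P \<inter> Q |P Q. P \<in> sets F \<and> Q \<in> sets G}"
proof (rule Int_stableI)
  fix a b
  assume "a \<in> {P \<inter> Q |P Q. P \<in> sets F \<and> Q \<in> sets G}" "b \<in> {P \<inter> Q |P Q. P \<in> sets F \<and> Q \<in> sets G}"
  then obtain P Q P' Q' where "a = P \<inter> Q" "b = P' \<inter> Q'" "P \<in> sets F" "P' \<in> sets F" "Q \<in> sets G" "Q' \<in> sets G"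
    by blast
  then show "a \<inter> b \<in> {P \<inter> Q |P Q. P \<in> sets F \<and> Q \<in> sets G}"
    by (intro CollectI exI[of _ "P \<inter> P'"] exI[of _ "Q \<inter> Q'"]) auto
qed

context prob_space
begin

lemma indep_var_imp_indep_set:
  assumes "indep_var S U T V"
  shows "indep_set (sets (vimage_algebra (space M) U S)) (sets (vimage_algebra (space M) V T))"
  using assms by (simp add: indep_var_eq sets_vimage_algebra)

text \<open>
  Functions measurable with respect to independent sigma-algebras are independent. The value types of
  \<open>f\<close> and \<open>g\<close> must agree, as \<open>indep_var\<close> demands; this is why independence of a real functional and a
  subvector is expressed through sigma-algebras below.
\<close>

lemma indep_set_imp_indep_var:
  assumes indep: "indep_set (sets F) (sets G)" and space: "space F = space M" "space G = space M"
    and f: "f \<in> measurable F S" and g: "g \<in> measurable G T"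
  shows "indep_var S f T g"
proof -
  have sub: "sets F \<subseteq> sets M" "sets G \<subseteq> sets M"
    using indep by (simp_all add: indep_sets2_eq)
  have fM: "f \<in> measurable M S" and gM: "g \<in> measurable M T"
    using f g measurable_mono[OF order_refl refl sub(1)] measurable_mono[OF order_refl refl sub(2)] space
    by auto
  have "sigma_sets (space M) {f -` A \<inter> space M |A. A \<in> sets S} \<subseteq> sets F"
    using measurable_sets[OF f] unfolding space(1)[symmetric]
    by (intro sets.sigma_sets_subset) auto
  moreover have "sigma_sets (space M) {g -` A \<inter> space M |A. A \<in> sets T} \<subseteq> sets G"
    using measurable_sets[OF g] unfolding space(2)[symmetric]
    by (intro sets.sigma_sets_subset) auto
  ultimately have "indep_set (sigma_sets (space M) {f -` A \<inter> space M |A. A \<in> sets S})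
      (sigma_sets (space M) {g -` A \<inter> space M |A. A \<in> sets T})"
    using indep unfolding indep_sets2_eq by blast
  then show ?thesis using fM gM by (simp add: indep_var_eq)
qed

text \<open>
  The sets on which \<open>f\<close> and \<open>g\<close> have the same integral form a Dynkin system.
\<close>

lemma set_integral_eq_from_generator:
  fixes f g :: "'a \<Rightarrow> real"
  assumes G: "Int_stable G" "G \<subseteq> events" "space M \<in> G"
    and int: "integrable M f" "integrable M g"
    and eq: "\<And>A. A \<in> G \<Longrightarrow> (\<integral>x\<in>A. f x \<partial>M) = (\<integral>x\<in>A. g x \<partial>M)"
    and D: "D \<in> sigma_sets (space M) G"
  shows "(\<integral>x\<in>D. f x \<partial>M) = (\<integral>x\<in>D. g x \<partial>M)"
proof -
  define h where "h x = f x - g x" for x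
  have h: "integrable M h" using int unfolding h_def by auto
  have seth: "set_integrable M A h" if "A \<in> events" for A
    using integrable_mult_indicator[OF that h] by (simp add: set_integrable_def)
  have diff: "(\<integral>x\<in>A. h x \<partial>M) = (\<integral>x\<in>A. f x \<partial>M) - (\<integral>x\<in>A. g x \<partial>M)" if "A \<in> events" for A
    unfolding h_def using integrable_mult_indicator[OF that int(1)] integrable_mult_indicator[OF that int(2)]
    by (intro set_integral_diff) (simp_all add: set_integrable_def)
  have closed: "G \<subseteq> Pow (space M)" using G(2) sets.sets_into_space by blast
  have ev: "A \<in> events" if "A \<in> sigma_sets (space M) G" for A
    using that G(2) sets.sigma_sets_subset by blast
  from G(1) closed D have "(\<integral>x\<in>D. h x \<partial>M) = 0"
  proof (induction rule: sigma_sets_induct_disjoint)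
    case (basic A)
    then show ?case using eq diff G(2) by auto
  next
    case empty
    then show ?case by (simp add: set_lebesgue_integral_def)
  next
    case (compl A)
    have "(\<integral>x\<in>space M. h x \<partial>M) = 0" using eq[OF G(3)] diff by simp
    moreover have "(\<integral>x\<in>A \<union> (space M - A). h x \<partial>M) = (\<integral>x\<in>A. h x \<partial>M) + (\<integral>x\<in>space M - A. h x \<partial>M)"
      using ev[OF compl(1)] by (intro set_integral_Un) (auto intro!: seth)
    moreover have "A \<union> (space M - A) = space M" using ev[OF compl(1)] sets.sets_into_space by blast
    ultimately show ?case using compl(2) by simp
  next
    case (union A)
    have A: "A i \<in> events" for i using union(2) ev by blast
    then have "(\<integral>x\<in>(\<Union>i. A i). h x \<partial>M) = (\<Sum>i. \<integral>x\<in>A i. h x \<partial>M)"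
      using union(1) by (intro lebesgue_integral_countable_add seth) (auto simp: disjoint_family_on_def)
    then show ?case using union(3) by simp
  qed
  then show ?thesis using diff[OF ev[OF D]] by simp
qed

lemma subalgebra_sigma_finite: "subalgebra M F \<Longrightarrow> sigma_finite_subalgebra M F"
  by (intro finite_measure_subalgebra_is_sigma_finite)
     (simp add: finite_measure_subalgebra_def finite_measure_axioms finite_measure_subalgebra_axioms_def)

text \<open>
  The product on the right is measurable with respect to \<open>F\<close>, and it suffices to integrate over the
  intersections \<open>P \<inter> Q\<close>. There both sides factor by independence of \<open>H1\<close> and \<open>H2\<close> into an integral over
  \<open>P\<close> and one over \<open>Q\<close>, and each factor is governed by its own conditional expectation.
\<close>

lemma cond_exp_Int_of_indep:
  assumes indep: "indep_set (sets H1) (sets H2)"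
    and H: "space H1 = space M" "space H2 = space M"
    and F1: "subalgebra H1 F1" and F2: "subalgebra H2 F2"
    and F: "sets F1 \<subseteq> sets F" "sets F2 \<subseteq> sets F" "space F = space M"
      "sets F \<subseteq> sigma_sets (space M) {P \<inter> Q |P Q. P \<in> sets F1 \<and> Q \<in> sets F2}"
    and K: "K \<in> sets H1" and L: "L \<in> sets H2"
  shows "AE x in M. real_cond_exp M F (indicator (K \<inter> L)) x
    = real_cond_exp M F1 (indicator K) x * real_cond_exp M F2 (indicator L) x"
proof -
  have HM: "sets H1 \<subseteq> events" "sets H2 \<subseteq> events" and
    prob_Int: "\<And>a b. a \<in> sets H1 \<Longrightarrow> b \<in> sets H2 \<Longrightarrow> prob (a \<inter> b) = prob a * prob b"
    using indep by (auto simp: indep_sets2_eq)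
  have F1M: "subalgebra M F1" and F2M: "subalgebra M F2"
    using F1 F2 HM H by (auto simp: subalgebra_def)
  let ?G = "{P \<inter> Q |P Q. P \<in> sets F1 \<and> Q \<in> sets F2}"
  have G: "?G \<subseteq> events" using F1M F2M by (auto simp: subalgebra_def)
  have FM: "subalgebra M F"
    using F(3,4) sets.sigma_sets_subset[OF G] by (auto simp: subalgebra_def)
  interpret F: sigma_finite_subalgebra M F using FM by (rule subalgebra_sigma_finite)
  interpret F1: sigma_finite_subalgebra M F1 using F1M by (rule subalgebra_sigma_finite)
  interpret F2: sigma_finite_subalgebra M F2 using F2M by (rule subalgebra_sigma_finite)
  let ?f = "real_cond_exp M F1 (indicator K)" and ?g = "real_cond_exp M F2 (indicator L)"
  have [measurable]: "K \<in> events" "L \<in> events" using K L HM by auto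
  have intK: "integrable M (indicator K :: 'a \<Rightarrow> real)" and intL: "integrable M (indicator L :: 'a \<Rightarrow> real)"
    by (auto simp: emeasure_eq_measure)
  have intf: "integrable M ?f" and intg: "integrable M ?g"
    using intK intL by (auto intro: F1.real_cond_exp_int F2.real_cond_exp_int)
  have F1H: "h \<in> borel_measurable H1" if "h \<in> borel_measurable F1" for h :: "'a \<Rightarrow> real"
    using measurable_from_subalg[OF F1 that] .
  have F2H: "h \<in> borel_measurable H2" if "h \<in> borel_measurable F2" for h :: "'a \<Rightarrow> real"
    using measurable_from_subalg[OF F2 that] .
  have indep_fun: "indep_var borel f borel g"
    if "f \<in> borel_measurable F1" "g \<in> borel_measurable F2" for f g :: "'a \<Rightarrow> real"
    using indep_set_imp_indep_var[OF indep H F1H[OF that(1)] F2H[OF that(2)]] .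
  have intfg: "integrable M (\<lambda>x. ?f x * ?g x)"
    by (rule indep_var_integrable[OF indep_fun intf intg]) auto
  show ?thesis
  proof (rule F.real_cond_exp_charact)
    show "integrable M (indicator (K \<inter> L) :: 'a \<Rightarrow> real)" by (auto simp: emeasure_eq_measure)
    show "integrable M (\<lambda>x. ?f x * ?g x)" by (rule intfg)
    have "?f \<in> borel_measurable F" "?g \<in> borel_measurable F"
      using measurable_from_subalg[of F F1 ?f borel] measurable_from_subalg[of F F2 ?g borel] F F1M F2M
      by (auto simp: subalgebra_def)
    then show "(\<lambda>x. ?f x * ?g x) \<in> borel_measurable F" by measurable
    fix A assume "A \<in> sets F"
    show "(\<integral>x\<in>A. indicator (K \<inter> L) x \<partial>M) = (\<integral>x\<in>A. ?f x * ?g x \<partial>M)"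
    proof (rule set_integral_eq_from_generator[of ?G])
      show "Int_stable ?G"
        by (rule Int_stable_Int_pairs)
      show "?G \<subseteq> events" by (rule G)
      show "space M \<in> ?G"
        using F1M F2M sets.top[of F1] sets.top[of F2] by (auto simp: subalgebra_def)
      show "integrable M (indicator (K \<inter> L) :: 'a \<Rightarrow> real)" by (auto simp: emeasure_eq_measure)
      show "integrable M (\<lambda>x. ?f x * ?g x)" by (rule intfg)
      show "A \<in> sigma_sets (space M) ?G" using F(4) \<open>A \<in> sets F\<close> by blast
      fix D assume "D \<in> ?G"
      then obtain P Q where D: "D = P \<inter> Q" and P: "P \<in> sets F1" and Q: "Q \<in> sets F2" by blast
      have [measurable]: "P \<in> events" "Q \<in> events" using P Q F1M F2M by (auto simp: subalgebra_def)
      have PH: "P \<in> sets H1" and QH: "Q \<in> sets H2" using P Q F1 F2 by (auto simp: subalgebra_def)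
      have fP: "(\<lambda>x. indicator P x * ?f x) \<in> borel_measurable F1" using P by measurable
      have gQ: "(\<lambda>x. indicator Q x * ?g x) \<in> borel_measurable F2" using Q by measurable
      have "(\<integral>x\<in>D. indicator (K \<inter> L) x \<partial>M) = prob ((K \<inter> P) \<inter> (L \<inter> Q))"
        unfolding set_lebesgue_integral_def D by (simp add: indicator_inter_arith[symmetric] Int_ac)
      also have "\<dots> = prob (K \<inter> P) * prob (L \<inter> Q)"
        using K L PH QH by (intro prob_Int) auto
      also have "prob (K \<inter> P) = (\<integral>x\<in>P. indicator K x \<partial>M)"
        unfolding set_lebesgue_integral_def by (simp add: indicator_inter_arith[symmetric] Int_ac)
      also have "\<dots> = (\<integral>x. indicator P x * ?f x \<partial>M)"
        using F1.real_cond_exp_intA[OF intK P] by (simp add: set_lebesgue_integral_def)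
      also have "prob (L \<inter> Q) = (\<integral>x\<in>Q. indicator L x \<partial>M)"
        unfolding set_lebesgue_integral_def by (simp add: indicator_inter_arith[symmetric] Int_ac)
      also have "\<dots> = (\<integral>x. indicator Q x * ?g x \<partial>M)"
        using F2.real_cond_exp_intA[OF intL Q] by (simp add: set_lebesgue_integral_def)
      also have "(\<integral>x. indicator P x * ?f x \<partial>M) * (\<integral>x. indicator Q x * ?g x \<partial>M)
          = (\<integral>x. (indicator P x * ?f x) * (indicator Q x * ?g x) \<partial>M)"
        using integrable_mult_indicator[OF \<open>P \<in> events\<close> intf] integrable_mult_indicator[OF \<open>Q \<in> events\<close> intg]
        by (intro indep_var_lebesgue_integral[OF indep_fun[OF fP gQ], symmetric]) simp_all
      also have "\<dots> = (\<integral>x\<in>D. ?f x * ?g x \<partial>M)"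
        unfolding set_lebesgue_integral_def D by (simp add: indicator_inter_arith mult_ac)
      finally show "(\<integral>x\<in>D. indicator (K \<inter> L) x \<partial>M) = (\<integral>x\<in>D. ?f x * ?g x \<partial>M)" .
    qed
  qed
qed

text \<open>
  Taking \<open>L\<close> or \<open>K\<close> to be the whole space in the previous factorization identifies its two factors as
  the conditional expectations given \<open>F\<close>.
\<close>

lemma cond_indep_of_indep:
  assumes indep: "indep_set (sets H1) (sets H2)"
    and H: "space H1 = space M" "space H2 = space M"
    and F1: "subalgebra H1 F1" and F2: "subalgebra H2 F2"
    and F: "sets F1 \<subseteq> sets F" "sets F2 \<subseteq> sets F" "space F = space M"
      "sets F \<subseteq> sigma_sets (space M) {P \<inter> Q |P Q. P \<in> sets F1 \<and> Q \<in> sets F2}"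
    and K: "K \<in> sets H1" and L: "L \<in> sets H2"
  shows "AE x in M. real_cond_exp M F (indicator (K \<inter> L)) x
    = real_cond_exp M F (indicator K) x * real_cond_exp M F (indicator L) x"
proof -
  have HM: "sets H1 \<subseteq> events" "sets H2 \<subseteq> events"
    using indep by (auto simp: indep_sets2_eq)
  have F1M: "subalgebra M F1" and F2M: "subalgebra M F2"
    using F1 F2 HM H by (auto simp: subalgebra_def)
  note E = cond_exp_Int_of_indep[OF indep H F1 F2 F]
  have one: "AE x in M. real_cond_exp M F' (indicator (space M)) x = 1" if F': "subalgebra M F'" for F'
  proof -
    interpret sigma_finite_subalgebra M F' using F' by (rule subalgebra_sigma_finite)
    have "space M \<in> sets F'" using F' sets.top[of F'] by (simp add: subalgebra_def)
    then have "AE x in M. real_cond_exp M F' (indicator (space M)) x = indicator (space M) x"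
      by (intro real_cond_exp_F_meas) (auto simp: emeasure_eq_measure)
    then show ?thesis using AE_space by eventually_elim simp
  qed
  have top: "space M \<in> sets H1" "space M \<in> sets H2"
    using sets.top[of H1] sets.top[of H2] H by simp_all
  have sub: "K \<inter> space M = K" "space M \<inter> L = L"
    using K L HM sets.sets_into_space by blast+
  show ?thesis
    using E[OF K L] E[OF K top(2)] E[OF top(1) L] one[OF F1M] one[OF F2M]
    unfolding sub by eventually_elim simp
qed

text \<open>
  Conditional independence of \<open>F1\<close> and \<open>F2\<close> given \<open>F\<close> says that an indicator of \<open>K \<in> F1\<close> has the same
  conditional expectation given \<open>F\<close> and \<open>F2\<close> jointly as given \<open>F\<close> alone. Since \<open>r\<close> is measurable with respect to
  the joint sigma-algebra, the integral of \<open>r\<close> over \<open>K\<close> equals the integral of \<open>r\<close> times an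
  \<open>F\<close>-measurable function; that integral is \<open>0\<close>, as \<open>r\<close> has mean \<open>0\<close> and is independent of \<open>F\<close>. So the
  conditional expectation of \<open>r\<close> given \<open>F1\<close> is \<open>0\<close>, and \<open>r\<close> is orthogonal to \<open>s\<close>.
\<close>

lemma cond_indep_imp_uncorrelated:
  fixes r s :: "'a \<Rightarrow> real"
  assumes F: "subalgebra M F" and F1: "subalgebra M F1" and F2: "subalgebra M F2"
    and ci: "\<And>K L. K \<in> sets F1 \<Longrightarrow> L \<in> sets F2 \<Longrightarrow> AE x in M. real_cond_exp M F (indicator (K \<inter> L)) x
        = real_cond_exp M F (indicator K) x * real_cond_exp M F (indicator L) x"
    and r: "r \<in> borel_measurable (sigma (space M) {L \<inter> Q |L Q. L \<in> sets F2 \<and> Q \<in> sets F})"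
    and r_int: "integrable M r" and r_mean: "expectation r = 0"
    and r_indep: "\<And>f. f \<in> borel_measurable F \<Longrightarrow> indep_var borel r borel f"
    and s: "s \<in> borel_measurable F1" and rs_int: "integrable M (\<lambda>x. s x * r x)"
  shows "expectation (\<lambda>x. s x * r x) = 0"
proof -
  interpret F: sigma_finite_subalgebra M F using F by (rule subalgebra_sigma_finite)
  interpret F1: sigma_finite_subalgebra M F1 using F1 by (rule subalgebra_sigma_finite)
  define G where "G = {L \<inter> Q |L Q. L \<in> sets F2 \<and> Q \<in> sets F}"
  have G: "G \<subseteq> events" using F F2 by (auto simp: subalgebra_def G_def)
  then have GP: "G \<subseteq> Pow (space M)" using sets.sets_into_space by blast
  have stable: "Int_stable G"
    unfolding G_def by (rule Int_stable_Int_pairs)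
  have top: "space M \<in> G"
    using F F2 sets.top[of F] sets.top[of F2] by (auto simp: subalgebra_def G_def)
  define S where "S = sigma (space M) G"
  have S: "subalgebra M S"
    using sets.sigma_sets_subset[OF G] GP by (auto simp: subalgebra_def S_def)
  interpret S: sigma_finite_subalgebra M S using S by (rule subalgebra_sigma_finite)
  have [measurable]: "r \<in> borel_measurable M" using r_int by simp
  have zero_on: "(\<integral>x. indicator K x * r x \<partial>M) = 0" if K: "K \<in> sets F1" for K
  proof -
    let ?k = "real_cond_exp M F (indicator K)"
    have [measurable]: "K \<in> events" using K F1 by (auto simp: subalgebra_def)
    have intK: "integrable M (indicator K :: 'a \<Rightarrow> real)" by (auto simp: emeasure_eq_measure)
    have intk: "integrable M ?k" using intK by (rule F.real_cond_exp_int)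
    have "AE x in M. real_cond_exp M S (\<lambda>x. indicator K x - ?k x) x = 0"
    proof (rule S.real_cond_exp_charact)
      show "integrable M (\<lambda>x. indicator K x - ?k x)" using intK intk by auto
      fix A assume "A \<in> sets S"
      then have A: "A \<in> sigma_sets (space M) G" using GP by (simp add: S_def)
      show "(\<integral>x\<in>A. indicator K x - ?k x \<partial>M) = (\<integral>x\<in>A. 0 \<partial>M)"
      proof (rule set_integral_eq_from_generator[OF stable G top _ _ _ A])
        show "integrable M (\<lambda>x. indicator K x - ?k x)" using intK intk by auto
        fix D assume "D \<in> G"
        then obtain L Q where D: "D = L \<inter> Q" and L: "L \<in> sets F2" and Q: "Q \<in> sets F"
          by (auto simp: G_def)
        have [measurable]: "L \<in> events" "Q \<in> events" using L Q F2 F by (auto simp: subalgebra_def)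
        have intL: "integrable M (indicator L :: 'a \<Rightarrow> real)"
          and intKL: "integrable M (indicator (K \<inter> L) :: 'a \<Rightarrow> real)" by (auto simp: emeasure_eq_measure)
        have Qk: "(\<lambda>x. indicator Q x * ?k x) \<in> borel_measurable F" using Q by measurable
        have intQkL: "integrable M (\<lambda>x. (indicator Q x * ?k x) * indicator L x)"
          using integrable_mult_indicator[of "Q \<inter> L" M ?k] intk
          by (simp add: indicator_inter_arith mult_ac)
        have "(\<integral>x\<in>D. indicat_real K x \<partial>M) = (\<integral>x\<in>Q. indicator (K \<inter> L) x \<partial>M)"
          unfolding set_lebesgue_integral_def D by (simp add: indicator_inter_arith mult_ac)
        also have "\<dots> = (\<integral>x\<in>Q. real_cond_exp M F (indicator (K \<inter> L)) x \<partial>M)"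
          by (rule F.real_cond_exp_intA[OF intKL Q])
        also have "\<dots> = (\<integral>x. (indicator Q x * ?k x) * real_cond_exp M F (indicator L) x \<partial>M)"
          unfolding set_lebesgue_integral_def using ci[OF K L]
          by (intro integral_cong_AE) (auto simp: mult_ac)
        also have "\<dots> = (\<integral>x. (indicator Q x * ?k x) * indicator L x \<partial>M)"
          by (rule F.real_cond_exp_intg[OF intQkL Qk]) simp
        also have "\<dots> = (\<integral>x\<in>D. ?k x \<partial>M)"
          unfolding set_lebesgue_integral_def D by (simp add: indicator_inter_arith mult_ac)
        finally have "(\<integral>x\<in>D. indicat_real K x \<partial>M) = (\<integral>x\<in>D. ?k x \<partial>M)" .
        moreover have "(\<integral>x\<in>D. indicator K x - ?k x \<partial>M) = (\<integral>x\<in>D. indicat_real K x \<partial>M) - (\<integral>x\<in>D. ?k x \<partial>M)"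
          using G \<open>D \<in> G\<close> integrable_mult_indicator[of D M "indicator K :: 'a \<Rightarrow> real"]
            integrable_mult_indicator[of D M ?k] intK intk
          by (intro set_integral_diff) (auto simp: set_integrable_def)
        ultimately show "(\<integral>x\<in>D. indicator K x - ?k x \<partial>M) = (\<integral>x\<in>D. 0 \<partial>M)"
          by (simp add: set_lebesgue_integral_def)
      qed simp
    qed simp_all
    have rk: "integrable M (\<lambda>x. r x * ?k x)"
      using r_indep[of ?k] r_int intk by (intro indep_var_integrable) auto
    have rK: "integrable M (\<lambda>x. r x * indicator K x)"
      using integrable_mult_indicator[of K M r] r_int by (simp add: mult.commute)
    have "(\<integral>x. r x * (indicator K x - ?k x) \<partial>M)
        = (\<integral>x. r x * real_cond_exp M S (\<lambda>x. indicator K x - ?k x) x \<partial>M)"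
      using rk rK r by (intro S.real_cond_exp_intg(2)[symmetric]) (auto simp: right_diff_distrib S_def G_def)
    also have "\<dots> = (\<integral>x. 0 \<partial>M)"
      using \<open>AE x in M. real_cond_exp M S (\<lambda>x. indicator K x - ?k x) x = 0\<close>
      by (intro integral_cong_AE) auto
    finally have "(\<integral>x. r x * indicator K x \<partial>M) = (\<integral>x. r x * ?k x \<partial>M)"
      using rk rK by (simp add: right_diff_distrib)
    also have "\<dots> = 0"
      using indep_var_lebesgue_integral[OF r_indep r_int intk] r_mean by simp
    finally show ?thesis by (simp add: mult.commute)
  qed
  have "AE x in M. real_cond_exp M F1 r x = 0"
    using zero_on r_int
    by (intro F1.real_cond_exp_charact) (auto simp: set_lebesgue_integral_def)
  then have "(\<integral>x. s x * real_cond_exp M F1 r x \<partial>M) = (\<integral>x. 0 \<partial>M)"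
    using measurable_from_subalg[OF F1 s] by (intro integral_cong_AE) auto
  then show ?thesis using F1.real_cond_exp_intg(2)[OF rs_int s] by simp
qed

end

section \<open>The normal density under a linear change of variables\<close>

text \<open>
  Uniqueness of Haar measure on a Euclidean space, up to a factor. For a function \<open>g\<close> whose reflected
  translates have Lebesgue integral \<open>1\<close>, Fubini and the invariance of both measures give
  \<open>\<integral> g dN \<cdot> \<integral> f dx = \<integral>\<integral> g(y) f(x + y) dx dN(y) = \<integral>\<integral> g(y - x) f(y) dN(y) dx = \<integral> f dN\<close>.
\<close>

lemma translation_invariant_eq_lborel:
  fixes N :: "'a::euclidean_space measure"
  assumes sets_N [measurable_cong]: "sets N = sets borel" and "sigma_finite_measure N"
    and inv: "\<And>t. distr N borel ((+) t) = N"
  obtains c where "\<And>f. f \<in> borel_measurable borel \<Longrightarrow> (\<integral>\<^sup>+y. f y \<partial>N) = c * (\<integral>\<^sup>+x. f x \<partial>lborel)"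
proof -
  interpret N: sigma_finite_measure N by fact
  interpret P: pair_sigma_finite lborel N ..
  \<comment> \<open>A unit cube, so that every reflected translate of \<open>g\<close> has Lebesgue integral \<open>1\<close>.\<close>
  define g :: "'a \<Rightarrow> ennreal" where "g = indicator (cbox 0 One)"
  have [measurable]: "g \<in> borel_measurable borel" unfolding g_def by measurable
  have g_reflect: "(\<integral>\<^sup>+x. g (y - x) \<partial>lborel) = 1" for y
  proof -
    have "g (y - x) = indicator (cbox (y - One) y) x" for x
      by (auto simp: g_def indicator_def mem_box inner_diff_left algebra_simps)
    then have "(\<integral>\<^sup>+x. g (y - x) \<partial>lborel) = emeasure lborel (cbox (y - One) y)"
      by simp
    then show ?thesis by (simp add: inner_diff_left)
  qed
  have shift_N: "(\<integral>\<^sup>+y. h (t + y) \<partial>N) = (\<integral>\<^sup>+y. h y \<partial>N)"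
    if [measurable]: "h \<in> borel_measurable borel" for h :: "'a \<Rightarrow> ennreal" and t
    by (subst (2) inv[of t, symmetric]) (simp add: nn_integral_distr)
  have shift_lborel: "(\<integral>\<^sup>+x. h (x + y) \<partial>lborel) = (\<integral>\<^sup>+x. h x \<partial>lborel)"
    if [measurable]: "h \<in> borel_measurable borel" for h :: "'a \<Rightarrow> ennreal" and y
    by (subst (2) lborel_distr_plus[of y, symmetric]) (simp add: nn_integral_distr add.commute)
  show ?thesis
  proof
    fix f :: "'a \<Rightarrow> ennreal" assume [measurable]: "f \<in> borel_measurable borel"
    have "(\<integral>\<^sup>+y. g y \<partial>N) * (\<integral>\<^sup>+x. f x \<partial>lborel) = (\<integral>\<^sup>+y. \<integral>\<^sup>+x. g y * f (x + y) \<partial>lborel \<partial>N)"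
      by (simp add: nn_integral_cmult nn_integral_multc shift_lborel)
    also have "\<dots> = (\<integral>\<^sup>+x. \<integral>\<^sup>+y. g y * f (x + y) \<partial>N \<partial>lborel)"
      by (rule P.Fubini') measurable
    also have "\<dots> = (\<integral>\<^sup>+x. \<integral>\<^sup>+y. g (y - x) * f y \<partial>N \<partial>lborel)"
    proof (rule nn_integral_cong)
      fix x
      show "(\<integral>\<^sup>+y. g y * f (x + y) \<partial>N) = (\<integral>\<^sup>+y. g (y - x) * f y \<partial>N)"
        using shift_N[of "\<lambda>y. g (y - x) * f y" x] by simp
    qed
    also have "\<dots> = (\<integral>\<^sup>+y. \<integral>\<^sup>+x. g (y - x) * f y \<partial>lborel \<partial>N)"
      by (rule P.Fubini'[symmetric]) measurable
    also have "\<dots> = (\<integral>\<^sup>+y. f y \<partial>N)"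
      by (simp add: nn_integral_multc g_reflect)
    finally show "(\<integral>\<^sup>+y. f y \<partial>N) = (\<integral>\<^sup>+y. g y \<partial>N) * (\<integral>\<^sup>+x. f x \<partial>lborel)" by simp
  qed
qed

text \<open>
  The factor is the inverse of \<open>\<bar>det T\<bar>\<close>. It is left open because the total mass \<open>1\<close> of a density
  determines it. The image of Lebesgue measure under \<open>T\<close> is translation invariant, since \<open>T\<close> is linear
  and onto.
\<close>

lemma nn_integral_lborel_affine:
  fixes T :: "real ^ 'n ^ 'n"
  assumes T: "invertible T"
  obtains c where "\<And>f. f \<in> borel_measurable borel \<Longrightarrow>
    (\<integral>\<^sup>+x. f (T *v (x - \<mu>)) \<partial>lborel) = c * (\<integral>\<^sup>+z. f z \<partial>lborel)"
proof -
  obtain T' where "T ** T' = mat 1" "T' ** T = mat 1"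
    using T unfolding invertible_def by blast
  then have T': "T *v (T' *v x) = x" "T' *v (T *v x) = x" for x
    by (simp_all add: matrix_vector_mul_assoc)
  have [measurable]: "(*v) A \<in> borel \<rightarrow>\<^sub>M borel" for A :: "real ^ 'n ^ 'n"
    by (intro borel_measurable_continuous_onI linear_continuous_on linear_conv_bounded_linear[THEN iffD1]) simp
  define N where "N = distr lborel borel ((*v) T)"
  have "sigma_finite_measure N"
  proof
    let ?\<A> = "range (\<lambda>n::nat. (*v) T' -` ball 0 (real n))"
    have "(*v) T' -` ball 0 r \<in> sets borel" for r
      using measurable_sets[of "(*v) T'" borel borel "ball 0 r"] by simp
    moreover have "(*v) T -` (*v) T' -` S = S" for S using T' by auto
    moreover have "x \<in> \<Union>?\<A>" for x
      using reals_Archimedean2[of "norm (T' *v x)"] by auto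
    ultimately show "\<exists>\<A>. countable \<A> \<and> \<A> \<subseteq> sets N \<and> \<Union>\<A> = space N \<and> (\<forall>a\<in>\<A>. emeasure N a \<noteq> \<infinity>)"
      using emeasure_lborel_ball_finite[where 'a = "real ^ 'n"]
      by (intro exI[of _ ?\<A>]) (auto simp: N_def emeasure_distr less_top[symmetric])
  qed
  moreover have "distr N borel ((+) t) = N" for t
  proof -
    have "distr N borel ((+) t) = distr (distr lborel borel ((+) (T' *v t))) borel ((*v) T)"
      unfolding N_def by (simp add: distr_distr o_def matrix_vector_right_distrib T')
    then show ?thesis by (simp add: lborel_distr_plus N_def)
  qed
  ultimately obtain c where
    c: "\<And>f. f \<in> borel_measurable borel \<Longrightarrow> (\<integral>\<^sup>+y. f y \<partial>N) = c * (\<integral>\<^sup>+x. f x \<partial>lborel)"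
    using translation_invariant_eq_lborel[of N] by (auto simp: N_def)
  show ?thesis
  proof
    fix f :: "real ^ 'n \<Rightarrow> ennreal" assume [measurable]: "f \<in> borel_measurable borel"
    have "(\<integral>\<^sup>+x. f (T *v (x - \<mu>)) \<partial>lborel) = (\<integral>\<^sup>+x. f (T *v x) \<partial>distr lborel borel ((+) (- \<mu>)))"
      by (subst nn_integral_distr) auto
    also have "\<dots> = (\<integral>\<^sup>+z. f z \<partial>N)"
      by (simp add: lborel_distr_plus N_def nn_integral_distr)
    finally show "(\<integral>\<^sup>+x. f (T *v (x - \<mu>)) \<partial>lborel) = c * (\<integral>\<^sup>+z. f z \<partial>lborel)"
      by (simp add: c)
  qed
qed

lemma nn_integral_lborel_vec_prod:
  fixes f :: "'n::finite \<Rightarrow> real \<Rightarrow> ennreal"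
  assumes [measurable]: "\<And>i. f i \<in> borel_measurable borel"
  shows "(\<integral>\<^sup>+x. (\<Prod>i\<in>UNIV. f i (x $ i)) \<partial>(lborel :: (real ^ 'n) measure)) = (\<Prod>i\<in>UNIV. \<integral>\<^sup>+t. f i t \<partial>lborel)"
proof -
  have Basis: "(Basis :: (real ^ 'n) set) = range (\<lambda>i. axis i 1)"
    by (auto simp: Basis_vec_def)
  have inj: "inj (\<lambda>i::'n. axis i (1::real))"
    by (auto simp: inj_on_def axis_eq_axis)
  have "(\<integral>\<^sup>+x. (\<Prod>b\<in>Basis. f (axis_index b) (x \<bullet> b)) \<partial>(lborel :: (real ^ 'n) measure))
      = (\<Prod>b\<in>(Basis :: (real ^ 'n) set). \<integral>\<^sup>+t. f (axis_index b) t \<partial>lborel)"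
    by (rule nn_integral_lborel_prod) auto
  then show ?thesis
    unfolding Basis by (simp add: prod.reindex[OF inj] axis_index_axis inner_axis o_def)
qed

lemma nn_integral_std_normal_density: "(\<integral>\<^sup>+t. ennreal (std_normal_density t) \<partial>lborel) = 1"
  using prob_space.emeasure_space_1[OF prob_space_normal_density[of 1 0]]
  by (simp add: emeasure_density)

text \<open>
  From \<open>T \<Sigma> T\<^sup>t = 1\<close> it follows that \<open>\<Sigma>\<^sup>-\<^sup>1 = T\<^sup>t T\<close>, so the exponent is \<open>- \<bar>T (x - \<mu>)\<bar>\<^sup>2 / 2\<close>, a sum over the
  coordinates. The normalizing factor \<open>k\<close> is left open, like the factor of the change of variables.
\<close>

lemma mv_normal_density_whitened:
  fixes T :: "real ^ 'n ^ 'n"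
  assumes T: "T ** \<Sigma> ** transpose T = mat 1"
  obtains k where "\<And>x. mv_normal_density \<mu> \<Sigma> x = k * (\<Prod>i\<in>UNIV. std_normal_density ((T *v (x - \<mu>)) $ i))"
proof
  fix x
  have 1: "transpose T ** T ** \<Sigma> = mat 1"
    using T matrix_left_right_inverse[of "T ** \<Sigma>" "transpose T"] by (simp add: matrix_mul_assoc)
  then have 2: "\<Sigma> ** (transpose T ** T) = mat 1"
    using matrix_left_right_inverse by blast
  have inv: "matrix_inv \<Sigma> = transpose T ** T"
    unfolding matrix_inv_def
  proof (rule some_equality)
    show "\<Sigma> ** (transpose T ** T) = mat 1 \<and> transpose T ** T ** \<Sigma> = mat 1" using 1 2 by simp
    show "A' = transpose T ** T" if "\<Sigma> ** A' = mat 1 \<and> A' ** \<Sigma> = mat 1" for A'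
      using that 1 2 by (metis matrix_mul_assoc matrix_mul_lid matrix_mul_rid)
  qed
  have "(x - \<mu>) \<bullet> (matrix_inv \<Sigma> *v (x - \<mu>)) = (T *v (x - \<mu>)) \<bullet> (T *v (x - \<mu>))"
    unfolding inv matrix_vector_mul_assoc[symmetric]
    by (metis dot_lmul_matrix transpose_transpose transpose_matrix_vector)
  also have "\<dots> = (\<Sum>i\<in>UNIV. ((T *v (x - \<mu>)) $ i)\<^sup>2)"
    by (simp add: inner_vec_def power2_eq_square)
  finally have quad: "(x - \<mu>) \<bullet> (matrix_inv \<Sigma> *v (x - \<mu>)) = (\<Sum>i\<in>UNIV. ((T *v (x - \<mu>)) $ i)\<^sup>2)" .
  have "(\<Prod>i\<in>UNIV. std_normal_density ((T *v (x - \<mu>)) $ i))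
      = (1 / sqrt (2 * pi)) ^ CARD('n) * exp (\<Sum>i\<in>UNIV. - ((T *v (x - \<mu>)) $ i)\<^sup>2 / 2)"
    unfolding std_normal_density_def prod.distrib exp_sum[OF finite_class.finite_UNIV] by simp
  then have "exp (\<Sum>i\<in>UNIV. - ((T *v (x - \<mu>)) $ i)\<^sup>2 / 2)
      = sqrt (2 * pi) ^ CARD('n) * (\<Prod>i\<in>UNIV. std_normal_density ((T *v (x - \<mu>)) $ i))"
    by (simp add: power_one_over)
  then show "mv_normal_density \<mu> \<Sigma> x = sqrt (2 * pi) ^ CARD('n) / sqrt ((2 * pi) ^ CARD('n) * det \<Sigma>)
      * (\<Prod>i\<in>UNIV. std_normal_density ((T *v (x - \<mu>)) $ i))"
    unfolding mv_normal_density_def quad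
    by (simp add: sum_divide_distrib sum_negf)
qed

section \<open>Independence and moments of linear functionals of a Gaussian vector\<close>

locale gaussian_vector = prob_space M + covariance_matrix \<Sigma>
  for M :: "'a measure" and X :: "'a \<Rightarrow> real ^ 'v" and \<mu> :: "real ^ 'v" and \<Sigma> :: "real ^ 'v ^ 'v" +
  assumes normal: "distributed M lborel X (\<lambda>x. ennreal (mv_normal_density \<mu> \<Sigma> x))"
begin

definition centred :: "real ^ 'v \<Rightarrow> 'a \<Rightarrow> real" where
  "centred a \<omega> = a \<bullet> (X \<omega> - \<mu>)"

lemma X_measurable [measurable]: "X \<in> borel_measurable M"
  using distributed_measurable[OF normal] by simp

lemma centred_measurable [measurable]: "centred a \<in> borel_measurable M"
  unfolding centred_def by measurable

text \<open>
  Coefficient vectors that are orthonormal for \<open>\<Sigma>\<close> give independent standard normal variables. With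
  these vectors as the rows of \<open>T\<close>, the density of \<open>T (X - \<mu>)\<close> is a product up to a constant, and
  the choice of the whole line for every \<open>A b\<close> shows that the constant is \<open>1\<close>.
\<close>

lemma emeasure_standard_coordinates:
  assumes B: "orthonormal B" "span B = UNIV" and A: "\<And>b. b \<in> B \<Longrightarrow> A b \<in> sets borel"
  shows "emeasure M {\<omega>\<in>space M. \<forall>b\<in>B. centred b \<omega> \<in> A b}
    = (\<Prod>b\<in>B. \<integral>\<^sup>+t. ennreal (std_normal_density t) * indicator (A b) t \<partial>lborel)"
proof -
  have "card B = CARD('v)"
    using orthonormal_independent[OF B(1)] B(2) by (metis DIM_cart DIM_real dim_UNIV dim_span_eq_card_independent mult.right_neutral)
  then obtain \<pi> where \<pi>: "bij_betw \<pi> (UNIV :: 'v set) B"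
    using B(1) by (metis finite_class.finite_UNIV finite_same_card_bij orthonormal_def)
  have piB: "\<pi> i \<in> B" for i using \<pi> bij_betwE by blast
  define T where "T = (\<chi> i. \<pi> i)"
  have T_apply: "(T *v x) $ i = \<pi> i \<bullet> x" for x i
    by (simp add: T_def matrix_vector_mult_def inner_vec_def)
  have "(T ** \<Sigma> ** transpose T) $ i $ j = cov (\<pi> i) (\<pi> j)" for i j
  proof -
    have "(T ** \<Sigma> ** transpose T) $ i $ j = ((T ** \<Sigma> ** transpose T) *v axis j 1) $ i"
      by (simp add: matrix_vector_mult_basis column_def)
    also have "\<dots> = \<pi> i \<bullet> (\<Sigma> *v (transpose T *v axis j 1))"
      by (simp add: matrix_vector_mul_assoc[symmetric] T_apply)
    also have "transpose T *v axis j 1 = \<pi> j"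
      by (simp add: matrix_vector_mult_basis column_transpose row_def T_def vec_nth_inverse)
    finally show ?thesis by (simp add: cov_form_def)
  qed
  moreover have "cov (\<pi> i) (\<pi> j) = mat 1 $ i $ j" for i j
    using B(1) piB bij_betw_imp_inj_on[OF \<pi>] by (auto simp: mat_def orthonormal_def dest: injD)
  ultimately have white: "T ** \<Sigma> ** transpose T = mat 1"
    by (simp add: vec_eq_iff)
  then have inv: "invertible T"
    by (metis invertible_right_inverse matrix_mul_assoc)
  obtain k where k: "\<And>x. mv_normal_density \<mu> \<Sigma> x = k * (\<Prod>i\<in>UNIV. std_normal_density ((T *v (x - \<mu>)) $ i))"
    using mv_normal_density_whitened[OF white] by blast
  obtain c where c: "\<And>f. f \<in> borel_measurable borel \<Longrightarrow>
      (\<integral>\<^sup>+x. f (T *v (x - \<mu>)) \<partial>lborel) = c * (\<integral>\<^sup>+z. f z \<partial>lborel)"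
    using nn_integral_lborel_affine[OF inv] by blast
  have upto_const: "emeasure M {\<omega>\<in>space M. \<forall>b\<in>B. centred b \<omega> \<in> A b}
      = ennreal k * c * (\<Prod>b\<in>B. \<integral>\<^sup>+t. ennreal (std_normal_density t) * indicator (A b) t \<partial>lborel)"
    if A: "\<And>b. b \<in> B \<Longrightarrow> A b \<in> sets borel" for A
  proof -
    let ?g = "\<lambda>z :: real ^ 'v. \<Prod>i\<in>UNIV. ennreal (std_normal_density (z $ i)) * indicator (A (\<pi> i)) (z $ i)"
    have [measurable]: "A (\<pi> i) \<in> sets borel" for i using A piB by blast
    let ?S = "{x. \<forall>i. (T *v (x - \<mu>)) $ i \<in> A (\<pi> i)}"
    have S [measurable]: "?S \<in> sets borel"
      unfolding T_apply by measurable
    have g [measurable]: "?g \<in> borel_measurable borel" by measurable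
    have gT: "(\<lambda>x. ?g (T *v (x - \<mu>))) \<in> borel_measurable borel"
      unfolding T_apply by measurable
    have "{\<omega>\<in>space M. \<forall>b\<in>B. centred b \<omega> \<in> A b} = X -` ?S \<inter> space M"
      using bij_betw_imp_surj_on[OF \<pi>] by (auto simp: centred_def T_apply)
    then have "emeasure M {\<omega>\<in>space M. \<forall>b\<in>B. centred b \<omega> \<in> A b}
        = (\<integral>\<^sup>+x. ennreal (mv_normal_density \<mu> \<Sigma> x) * indicator ?S x \<partial>lborel)"
      using distributed_emeasure[OF normal, of ?S] S by simp
    also have "\<dots> = (\<integral>\<^sup>+x. ennreal k * ?g (T *v (x - \<mu>)) \<partial>lborel)"
    proof (rule nn_integral_cong)
      fix x
      have "indicator ?S x = (\<Prod>i\<in>UNIV. indicator (A (\<pi> i)) ((T *v (x - \<mu>)) $ i) :: ennreal)"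
        by (auto simp: indicator_def prod_zero_iff)
      then show "ennreal (mv_normal_density \<mu> \<Sigma> x) * indicator ?S x = ennreal k * ?g (T *v (x - \<mu>))"
        unfolding k
        by (simp add: prod.distrib prod_ennreal ennreal_mult'' prod_nonneg mult.assoc)
    qed
    also have "\<dots> = ennreal k * (c * (\<integral>\<^sup>+z. ?g z \<partial>lborel))"
      using gT by (simp add: nn_integral_cmult c[OF g])
    also have "(\<integral>\<^sup>+z. ?g z \<partial>lborel) = (\<Prod>i\<in>UNIV. \<integral>\<^sup>+t. ennreal (std_normal_density t) * indicator (A (\<pi> i)) t \<partial>lborel)"
      by (rule nn_integral_lborel_vec_prod) simp
    also have "\<dots> = (\<Prod>b\<in>B. \<integral>\<^sup>+t. ennreal (std_normal_density t) * indicator (A b) t \<partial>lborel)"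
      by (rule prod.reindex_bij_betw[OF \<pi>])
    finally show ?thesis by (simp add: mult.assoc)
  qed
  have "ennreal k * c = 1"
    using upto_const[of "\<lambda>_. UNIV"] by (simp add: nn_integral_std_normal_density emeasure_space_1)
  then show ?thesis using upto_const[OF A] by simp
qed

lemma standard_coordinate_normal:
  assumes B: "orthonormal B" "span B = UNIV" and b: "b \<in> B"
  shows "distributed M lborel (centred b) std_normal_density"
proof -
  have "distr M lborel (centred b) = density lborel std_normal_density"
  proof (rule measure_eqI)
    fix A assume "A \<in> sets (distr M lborel (centred b))"
    then have [measurable]: "A \<in> sets borel" by simp
    have "emeasure (distr M lborel (centred b)) A
        = emeasure M {\<omega>\<in>space M. \<forall>c\<in>B. centred c \<omega> \<in> (if c = b then A else UNIV)}"
      using b by (auto simp: emeasure_distr intro!: arg_cong[where f="emeasure M"])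
    also have "\<dots> = (\<Prod>c\<in>B. \<integral>\<^sup>+t. ennreal (std_normal_density t) * indicator (if c = b then A else UNIV) t \<partial>lborel)"
      by (rule emeasure_standard_coordinates[OF B]) auto
    also have "\<dots> = (\<Prod>c\<in>B. if c = b then \<integral>\<^sup>+t. ennreal (std_normal_density t) * indicator A t \<partial>lborel else 1)"
      by (intro prod.cong) (auto simp: nn_integral_std_normal_density)
    also have "\<dots> = (\<integral>\<^sup>+t. ennreal (std_normal_density t) * indicator A t \<partial>lborel)"
      using b B(1) by (simp add: orthonormal_def)
    finally show "emeasure (distr M lborel (centred b)) A = emeasure (density lborel std_normal_density) A"
      by (simp add: emeasure_density)
  qed simp
  then show ?thesis by (simp add: distributed_def)
qed

lemma standard_coordinates_indep:
  assumes B: "orthonormal B" "span B = UNIV"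
  shows "indep_vars (\<lambda>_. borel) centred B"
proof -
  have fin: "finite B" using B(1) by (simp add: orthonormal_def)
  have "B \<noteq> {}"
  proof
    assume "B = {}"
    then have "(axis undefined 1 :: real ^ 'v) \<in> {0}" using B(2) by auto
    then show False by (simp add: axis_eq_0_iff)
  qed
  show ?thesis
  proof (subst indep_vars_finite[where E="\<lambda>_. sets borel"])
    show "\<forall>A\<in>B \<rightarrow> sets borel. prob (\<Inter>b\<in>B. centred b -` A b \<inter> space M) = (\<Prod>b\<in>B. prob (centred b -` A b \<inter> space M))"
    proof
      fix A :: "real ^ 'v \<Rightarrow> real set" assume A: "A \<in> B \<rightarrow> sets borel"
      have eq: "(\<Inter>b\<in>B. centred b -` A b \<inter> space M) = {\<omega>\<in>space M. \<forall>b\<in>B. centred b \<omega> \<in> A b}"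
        using \<open>B \<noteq> {}\<close> by auto
      have "emeasure M (\<Inter>b\<in>B. centred b -` A b \<inter> space M) = (\<Prod>b\<in>B. emeasure M (centred b -` A b \<inter> space M))"
        unfolding eq using A
        by (subst emeasure_standard_coordinates[OF B])
           (auto intro!: prod.cong distributed_emeasure[OF standard_coordinate_normal[OF B], symmetric])
      then show "prob (\<Inter>b\<in>B. centred b -` A b \<inter> space M) = (\<Prod>b\<in>B. prob (centred b -` A b \<inter> space M))"
        by (simp add: emeasure_eq_measure prod_ennreal prod_nonneg)
    qed
  qed (use \<open>B \<noteq> {}\<close> fin in \<open>auto simp: sets.sigma_sets_eq[of borel, simplified] Int_stable_def\<close>)
qed

lemma centred_expansion:
  assumes "a = (\<Sum>b\<in>B. f b *\<^sub>R b)"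
  shows "centred a \<omega> = (\<Sum>b\<in>B. f b * centred b \<omega>)"
  unfolding assms by (simp add: centred_def inner_sum_left)

lemma centred_moments:
  shows centred_integrable: "integrable M (centred a)"
    and centred_expectation: "expectation (centred a) = 0"
    and centred_mult_integrable: "integrable M (\<lambda>\<omega>. centred a \<omega> * centred c \<omega>)"
    and centred_mult_expectation: "expectation (\<lambda>\<omega>. centred a \<omega> * centred c \<omega>) = cov a c"
proof -
  obtain B where B: "orthonormal B" "span B = UNIV"
    using orthonormal_extend[of UNIV "{}"] by (auto simp: orthonormal_def)
  have fin: "finite B" using B(1) by (simp add: orthonormal_def)
  have int1: "integrable M (centred b)" if "b \<in> B" for b
    using distributed_integrable[OF standard_coordinate_normal[OF B that], of "\<lambda>x. x"]
      integrable_std_normal_moment[of 1] by simp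
  have exp1: "expectation (centred b) = 0" if "b \<in> B" for b
    using distributed_integral[OF standard_coordinate_normal[OF B that], of "\<lambda>x. x"]
      integral_std_normal_moment_odd[of 0] by simp
  have int2: "integrable M (\<lambda>\<omega>. centred b \<omega> * centred c \<omega>)" 
    and exp2: "expectation (\<lambda>\<omega>. centred b \<omega> * centred c \<omega>) = (if b = c then 1 else 0)"
    if bc: "b \<in> B" "c \<in> B" for b c
  proof -
    have "integrable M (\<lambda>\<omega>. centred b \<omega> * centred c \<omega>) \<and>
      expectation (\<lambda>\<omega>. centred b \<omega> * centred c \<omega>) = (if b = c then 1 else 0)"
    proof (cases "b = c")
      case True
      then show ?thesis
        using distributed_integrable[OF standard_coordinate_normal[OF B bc(1)], of "\<lambda>x. x * x"]
          distributed_integral[OF standard_coordinate_normal[OF B bc(1)], of "\<lambda>x. x * x"]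
          integrable_std_normal_moment[of 2] integral_std_normal_moment_even[of 1]
        by (simp add: power2_eq_square)
    next
      case False
      have "indep_var borel ((\<lambda>f. f b) \<circ> (\<lambda>\<omega>. \<lambda>i\<in>{b}. centred i \<omega>)) borel ((\<lambda>f. f c) \<circ> (\<lambda>\<omega>. \<lambda>i\<in>{c}. centred i \<omega>))"
        using False bc by (intro indep_var_compose[OF indep_var_restrict[OF standard_coordinates_indep[OF B]]]) auto
      then have "indep_var borel (centred b) borel (centred c)" by (simp add: o_def)
      then show ?thesis
        using False indep_var_lebesgue_integral[OF _ int1 int1] indep_var_integrable[OF _ int1 int1] exp1 bc
        by auto
    qed
    then show "integrable M (\<lambda>\<omega>. centred b \<omega> * centred c \<omega>)"
      "expectation (\<lambda>\<omega>. centred b \<omega> * centred c \<omega>) = (if b = c then 1 else 0)" by auto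
  qed
  have expand: "centred a = (\<lambda>\<omega>. \<Sum>b\<in>B. cov b a * centred b \<omega>)" for a
    using centred_expansion[OF orthonormal_expansion[OF B(1)]] B(2) by blast
  show "integrable M (centred a)" unfolding expand[of a]
    by (intro Bochner_Integration.integrable_sum integrable_mult_right int1)
  show "expectation (centred a) = 0" unfolding expand[of a]
    by (simp add: Bochner_Integration.integral_sum int1 exp1)
  have prod: "centred a \<omega> * centred c \<omega> 
      = (\<Sum>b\<in>B. \<Sum>d\<in>B. cov b a * cov d c * (centred b \<omega> * centred d \<omega>))" for \<omega>
    unfolding expand[of a] expand[of c] by (simp add: sum_product algebra_simps)
  show "integrable M (\<lambda>\<omega>. centred a \<omega> * centred c \<omega>)"
    unfolding prod by (intro Bochner_Integration.integrable_sum integrable_mult_right int2)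
  have "expectation (\<lambda>\<omega>. centred a \<omega> * centred c \<omega>)
      = (\<Sum>b\<in>B. \<Sum>d\<in>B. cov b a * cov d c * (if b = d then 1 else 0))"
    unfolding prod by (simp add: Bochner_Integration.integral_sum int2 exp2)
  also have "\<dots> = (\<Sum>b\<in>B. \<Sum>d\<in>B. if b = d then cov d c * cov b a else 0)"
    by (intro sum.cong) auto
  also have "\<dots> = (\<Sum>b\<in>B. cov b c * cov a b)"
    using fin by (simp add: cov_commute[of a])
  also have "\<dots> = cov a (\<Sum>b\<in>B. cov b c *\<^sub>R b)" by (simp add: cov_simps)
  also have "\<dots> = cov a c" using orthonormal_expansion[OF B(1), of c] B(2) by simp
  finally show "expectation (\<lambda>\<omega>. centred a \<omega> * centred c \<omega>) = cov a c" .
qed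

text \<open>
  Take an orthonormal basis \<open>B1\<close> of the span of the \<open>a i\<close> and extend it to an orthonormal basis \<open>B\<close> of the
  whole space. The first family is a function of the coordinates in \<open>B1\<close>, and the second, being
  orthogonal to \<open>B1\<close>, of those in \<open>B - B1\<close>.
\<close>

lemma uncorrelated_families_indep:
  assumes "\<And>i j. i \<in> I \<Longrightarrow> j \<in> J \<Longrightarrow> cov (a i) (c j) = 0"
  shows "indep_var (\<Pi>\<^sub>M i\<in>I. borel) (\<lambda>\<omega>. \<lambda>i\<in>I. centred (a i) \<omega>)
                   (\<Pi>\<^sub>M j\<in>J. borel) (\<lambda>\<omega>. \<lambda>j\<in>J. centred (c j) \<omega>)"
proof -
  define U where "U = span (a ` I)"
  obtain B1 where B1: "orthonormal B1" "B1 \<subseteq> U" "span B1 = U"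
    using orthonormal_extend[of U "{}"] by (auto simp: U_def orthonormal_def)
  obtain B where B: "B1 \<subseteq> B" "orthonormal B" "span B = UNIV"
    using orthonormal_extend[of UNIV B1] B1(1) by auto
  have fin: "finite B" using B(2) by (simp add: orthonormal_def)
  have left: "centred (a i) \<omega> = (\<Sum>b\<in>B1. cov b (a i) * centred b \<omega>)" if "i \<in> I" for i \<omega>
    using centred_expansion[OF orthonormal_expansion[OF B1(1)], of "a i" \<omega>] B1(3) that
    by (simp add: U_def span_base)
  have right: "centred (c j) \<omega> = (\<Sum>b\<in>B - B1. cov b (c j) * centred b \<omega>)" if "j \<in> J" for j \<omega>
  proof -
    have "cov b (c j) = 0" if "b \<in> B1" for b
      using cov_span_eq_0[of "a ` I" "c j" b] assms \<open>j \<in> J\<close> B1(2) that by (auto simp: U_def)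
    then have "(\<Sum>b\<in>B - B1. cov b (c j) * centred b \<omega>) = (\<Sum>b\<in>B. cov b (c j) * centred b \<omega>)"
      using fin by (intro sum.mono_neutral_left) auto
    then show ?thesis
      using centred_expansion[OF orthonormal_expansion[OF B(2)], of "c j" \<omega>] B(3) by simp
  qed
  have "indep_var (\<Pi>\<^sub>M b\<in>B1. borel) (\<lambda>\<omega>. \<lambda>b\<in>B1. centred b \<omega>) (\<Pi>\<^sub>M b\<in>B - B1. borel) (\<lambda>\<omega>. \<lambda>b\<in>B - B1. centred b \<omega>)"
    using indep_var_restrict[OF standard_coordinates_indep[OF B(2,3)], of B1 "B - B1"] B(1) by auto
  then have "indep_var (\<Pi>\<^sub>M i\<in>I. borel) ((\<lambda>f. \<lambda>i\<in>I. \<Sum>b\<in>B1. cov b (a i) * f b) \<circ> (\<lambda>\<omega>. \<lambda>b\<in>B1. centred b \<omega>))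
                   (\<Pi>\<^sub>M j\<in>J. borel) ((\<lambda>f. \<lambda>j\<in>J. \<Sum>b\<in>B - B1. cov b (c j) * f b) \<circ> (\<lambda>\<omega>. \<lambda>b\<in>B - B1. centred b \<omega>))"
    by (rule indep_var_compose) measurable
  then show ?thesis
    by (simp add: o_def left right cong: restrict_cong)
qed

lemma coordinate_eq_centred: "X \<omega> $ v = centred (axis v 1) \<omega> + \<mu> $ v"
  by (simp add: centred_def inner_axis')

lemma coordinate_measurable [measurable]: "(\<lambda>\<omega>. X \<omega> $ v) \<in> borel_measurable M"
  unfolding coordinate_eq_centred by measurable

lemma uncorrelated_subvectors_indep:
  assumes "\<And>u v. u \<in> A \<Longrightarrow> v \<in> B \<Longrightarrow> \<Sigma> $ u $ v = 0"
  shows "indep_var (\<Pi>\<^sub>M v\<in>A. borel) (subvector X A) (\<Pi>\<^sub>M v\<in>B. borel) (subvector X B)"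
proof -
  have "indep_var (\<Pi>\<^sub>M v\<in>A. borel) (\<lambda>\<omega>. \<lambda>v\<in>A. centred (axis v 1) \<omega>)
                  (\<Pi>\<^sub>M v\<in>B. borel) (\<lambda>\<omega>. \<lambda>v\<in>B. centred (axis v 1) \<omega>)"
    using assms by (intro uncorrelated_families_indep) (auto simp: cov_form_axis_axis)
  then have "indep_var
      (\<Pi>\<^sub>M v\<in>A. borel) ((\<lambda>f. \<lambda>v\<in>A. f v + \<mu> $ v) \<circ> (\<lambda>\<omega>. \<lambda>v\<in>A. centred (axis v 1) \<omega>))
      (\<Pi>\<^sub>M v\<in>B. borel) ((\<lambda>f. \<lambda>v\<in>B. f v + \<mu> $ v) \<circ> (\<lambda>\<omega>. \<lambda>v\<in>B. centred (axis v 1) \<omega>))"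
    by (rule indep_var_compose) measurable
  then show ?thesis
    by (simp add: o_def subvector_def[abs_def] coordinate_eq_centred cong: restrict_cong)
qed

text \<open>
  A linear functional uncorrelated with \<open>X\<^sub>C\<close> is independent of everything that \<open>X\<^sub>C\<close> determines.
\<close>

lemma residual_indep_subvector:
  assumes y: "\<And>c. c \<in> C \<Longrightarrow> cov (axis c 1) y = 0"
    and f: "f \<in> borel_measurable (vimage_algebra (space M) (subvector X C) (\<Pi>\<^sub>M v\<in>C. borel))"
  shows "indep_var borel (centred y) borel f"
proof -
  \<comment> \<open>\<open>?Y\<close> packs the single functional as a family over the index type of \<open>X\<close>, since both families must have the same type.\<close>
  let ?Z = "\<lambda>A. \<lambda>\<omega>. \<lambda>v\<in>A. centred (axis v 1) \<omega>" and ?Y = "\<lambda>\<omega>. \<lambda>i\<in>{undefined :: 'v}. centred y \<omega>"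
  have "indep_var (\<Pi>\<^sub>M i\<in>{undefined}. borel) ?Y (\<Pi>\<^sub>M v\<in>C. borel) (?Z C)"
    using y by (intro uncorrelated_families_indep) (auto simp: cov_commute[of y])
  then have "indep_var
      (\<Pi>\<^sub>M i\<in>{undefined}. borel) ((\<lambda>f. f) \<circ> ?Y)
      (\<Pi>\<^sub>M v\<in>C. borel) ((\<lambda>f. \<lambda>v\<in>C. f v + \<mu> $ v) \<circ> ?Z C)"
    by (rule indep_var_compose) measurable
  then have "indep_var (\<Pi>\<^sub>M i\<in>{undefined}. borel) ?Y (\<Pi>\<^sub>M v\<in>C. borel) (subvector X C)"
    by (simp add: o_def subvector_def[abs_def] coordinate_eq_centred cong: restrict_cong)
  then have "indep_set (sets (vimage_algebra (space M) ?Y (\<Pi>\<^sub>M i\<in>{undefined}. borel)))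
      (sets (vimage_algebra (space M) (subvector X C) (\<Pi>\<^sub>M v\<in>C. borel)))"
    by (rule indep_var_imp_indep_set)
  moreover have "(\<lambda>\<omega>. ?Y \<omega> undefined) \<in> borel_measurable (vimage_algebra (space M) ?Y (\<Pi>\<^sub>M i\<in>{undefined}. borel))"
    by (rule measurable_compose[OF measurable_vimage_algebra1]) (auto simp: space_PiM split: if_splits)
  ultimately show ?thesis
    using indep_set_imp_indep_var[OF _ _ _ _ f] by simp
qed

lemma indep_coordinates_iff:
  "indep_var borel (\<lambda>\<omega>. X \<omega> $ u) borel (\<lambda>\<omega>. X \<omega> $ v) \<longleftrightarrow> \<Sigma> $ u $ v = 0"
proof
  assume "indep_var borel (\<lambda>\<omega>. X \<omega> $ u) borel (\<lambda>\<omega>. X \<omega> $ v)"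
  then have "indep_var borel ((\<lambda>t. t - \<mu> $ u) \<circ> (\<lambda>\<omega>. X \<omega> $ u)) borel ((\<lambda>t. t - \<mu> $ v) \<circ> (\<lambda>\<omega>. X \<omega> $ v))"
    by (rule indep_var_compose) measurable
  then have "indep_var borel (centred (axis u 1)) borel (centred (axis v 1))"
    by (simp add: o_def coordinate_eq_centred)
  from indep_var_lebesgue_integral[OF this centred_integrable centred_integrable]
  show "\<Sigma> $ u $ v = 0"
    by (simp add: centred_mult_expectation centred_expectation cov_form_axis_axis)
next
  assume "\<Sigma> $ u $ v = 0"
  then have "indep_var (\<Pi>\<^sub>M v\<in>{u}. borel) (subvector X {u}) (\<Pi>\<^sub>M v\<in>{v}. borel) (subvector X {v})"
    by (intro uncorrelated_subvectors_indep) simp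
  then have "indep_var borel ((\<lambda>f. f u) \<circ> subvector X {u}) borel ((\<lambda>f. f v) \<circ> subvector X {v})"
    by (rule indep_var_compose) measurable
  then show "indep_var borel (\<lambda>\<omega>. X \<omega> $ u) borel (\<lambda>\<omega>. X \<omega> $ v)"
    by (simp add: o_def subvector_def)
qed

lemma covariance_graph_eq: "covariance_graph M X = {(u, v). u \<noteq> v \<and> \<Sigma> $ u $ v \<noteq> 0}"
  by (simp add: covariance_graph_def indep_coordinates_iff)

end

section \<open>Covariance faithfulness\<close>

context gaussian_vector
begin

definition subvector_algebra :: "'v set \<Rightarrow> 'a measure" where
  "subvector_algebra A = vimage_algebra (space M) (subvector X A) (\<Pi>\<^sub>M v\<in>A. borel)"

lemma subvector_measurable [measurable]: "subvector X A \<in> measurable M (\<Pi>\<^sub>M v\<in>A. borel)"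
  unfolding subvector_def[abs_def] by measurable

lemma space_subvector_algebra [simp]: "space (subvector_algebra A) = space M"
  by (simp add: subvector_algebra_def)

lemma sets_subvector_algebra:
  "sets (subvector_algebra A) = {subvector X A -` K \<inter> space M |K. K \<in> sets (\<Pi>\<^sub>M v\<in>A. borel)}"
  unfolding subvector_algebra_def
  by (rule sets_vimage_algebra2) (use measurable_space[OF subvector_measurable[of A]] in auto)

lemma coordinate_subvector_algebra:
  assumes "v \<in> A"
  shows "(\<lambda>\<omega>. X \<omega> $ v) \<in> borel_measurable (subvector_algebra A)"
proof -
  have "subvector X A \<in> measurable (subvector_algebra A) (\<Pi>\<^sub>M v\<in>A. borel)"
    unfolding subvector_algebra_def
    by (rule measurable_vimage_algebra1) (use measurable_space[OF subvector_measurable[of A]] in auto)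
  from measurable_compose[OF this measurable_component_singleton[OF assms]] assms
  show ?thesis by (simp add: subvector_def)
qed

lemma subvector_algebra_least:
  assumes "space N = space M" "\<And>v. v \<in> A \<Longrightarrow> (\<lambda>\<omega>. X \<omega> $ v) \<in> borel_measurable N"
  shows "sets (subvector_algebra A) \<subseteq> sets N"
  unfolding subvector_algebra_def
proof (rule sets_image_in_sets)
  show "subvector X A \<in> measurable N (\<Pi>\<^sub>M v\<in>A. borel)"
    unfolding subvector_def[abs_def] using assms(2) by (rule measurable_restrict)
qed (fact assms(1))

lemma subvector_algebra_mono: "A \<subseteq> B \<Longrightarrow> sets (subvector_algebra A) \<subseteq> sets (subvector_algebra B)"
  by (intro subvector_algebra_least) (auto intro: coordinate_subvector_algebra)

lemma subalgebra_subvector_algebra: "subalgebra M (subvector_algebra A)"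
  unfolding subalgebra_def using subvector_algebra_least[of M A] coordinate_measurable by simp

text \<open>
  Intersections \<open>P \<inter> Q\<close> generate the joint sigma-algebra of two subvectors; unlike unions of the two
  sigma-algebras they are closed under intersection, as the uniqueness argument for integrals needs.
\<close>

lemma coordinate_joint_algebra:
  assumes "v \<in> A \<union> B"
  shows "(\<lambda>\<omega>. X \<omega> $ v) \<in> borel_measurable
    (sigma (space M) {P \<inter> Q |P Q. P \<in> sets (subvector_algebra A) \<and> Q \<in> sets (subvector_algebra B)})"
    (is "_ \<in> borel_measurable ?N")
proof -
  let ?G = "{P \<inter> Q |P Q. P \<in> sets (subvector_algebra A) \<and> Q \<in> sets (subvector_algebra B)}"
  have Pow: "?G \<subseteq> Pow (space M)"
    using sets.sets_into_space[of _ "subvector_algebra A"] by auto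
  have "P \<in> ?G" if "P \<in> sets (subvector_algebra A)" for P
  proof -
    have "P = P \<inter> space M" using that sets.sets_into_space[of P "subvector_algebra A"] by auto
    then show ?thesis using that sets.top[of "subvector_algebra B"] by auto
  qed
  moreover have "Q \<in> ?G" if "Q \<in> sets (subvector_algebra B)" for Q
  proof -
    have "Q = space M \<inter> Q" using that sets.sets_into_space[of Q "subvector_algebra B"] by auto
    then show ?thesis using that sets.top[of "subvector_algebra A"] by auto
  qed
  ultimately have "sets (subvector_algebra A) \<subseteq> sets ?N" "sets (subvector_algebra B) \<subseteq> sets ?N"
    using Pow by auto
  then have "subalgebra ?N (subvector_algebra A)" "subalgebra ?N (subvector_algebra B)"
    using Pow by (simp_all add: subalgebra_def)
  then show ?thesis
    using assms measurable_from_subalg coordinate_subvector_algebra by blast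
qed

lemma cond_indep_subvectors_iff:
  "cond_indep_subvectors M X A B C \<longleftrightarrow>
    (\<forall>K\<in>sets (subvector_algebra A). \<forall>L\<in>sets (subvector_algebra B). AE \<omega> in M.
      real_cond_exp M (subvector_algebra C) (indicator (K \<inter> L)) \<omega> =
      real_cond_exp M (subvector_algebra C) (indicator K) \<omega> *
      real_cond_exp M (subvector_algebra C) (indicator L) \<omega>)"
  unfolding cond_indep_subvectors_def cond_indep_var_def Let_def subvector_algebra_def[of C, symmetric]
    sets_subvector_algebra
  by (auto; blast)

text \<open>
  Conditioning on \<open>C\<close> splits into conditioning on the two parts of \<open>C\<close> on either side of the cut.
\<close>

lemma separates_imp_cond_indep:
  assumes sep: "separates UNIV (covariance_graph M X) S A B"
    and disj: "disjnt A B" "disjnt A S" "disjnt B S"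
  shows "cond_indep_subvectors M X A B (UNIV - (A \<union> B \<union> S))"
proof -
  define C where "C = UNIV - (A \<union> B \<union> S)"
  obtain A' B' where cut: "A \<subseteq> A'" "B \<subseteq> B'" "A' \<union> B' = - S" "A' \<inter> B' = {}"
    "\<And>a b. a \<in> A' \<Longrightarrow> b \<in> B' \<Longrightarrow> (a, b) \<notin> covariance_graph M X"
    using separates_cut[OF sep disj(2,3)] by blast
  have "\<Sigma> $ a $ b = 0" if "a \<in> A'" "b \<in> B'" for a b
    using cut(4) cut(5)[OF that] that by (auto simp: covariance_graph_eq)
  then have indep: "indep_set (sets (subvector_algebra A')) (sets (subvector_algebra B'))"
    unfolding subvector_algebra_def
    by (intro indep_var_imp_indep_set uncorrelated_subvectors_indep)
  have C: "C = (C \<inter> A') \<union> (C \<inter> B')" using cut(3) by (auto simp: C_def)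
  let ?G = "{P \<inter> Q |P Q. P \<in> sets (subvector_algebra (C \<inter> A')) \<and> Q \<in> sets (subvector_algebra (C \<inter> B'))}"
  have Pow: "?G \<subseteq> Pow (space M)"
    using sets.sets_into_space[of _ "subvector_algebra (C \<inter> A')"] by auto
  have "sets (subvector_algebra C) \<subseteq> sets (sigma (space M) ?G)"
    using C Pow by (intro subvector_algebra_least coordinate_joint_algebra) auto
  then have gen: "sets (subvector_algebra C) \<subseteq> sigma_sets (space M) ?G"
    using Pow by simp
  show ?thesis
    unfolding C_def[symmetric] cond_indep_subvectors_iff
  proof (intro ballI)
    fix K L assume "K \<in> sets (subvector_algebra A)" "L \<in> sets (subvector_algebra B)"
    then have "K \<in> sets (subvector_algebra A')" "L \<in> sets (subvector_algebra B')"
      using subvector_algebra_mono cut(1,2) by blast+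
    then show "AE \<omega> in M.
      real_cond_exp M (subvector_algebra C) (indicator (K \<inter> L)) \<omega> =
      real_cond_exp M (subvector_algebra C) (indicator K) \<omega> *
      real_cond_exp M (subvector_algebra C) (indicator L) \<omega>"
      by (intro cond_indep_of_indep[OF indep, where ?F1.0 = "subvector_algebra (C \<inter> A')"
            and ?F2.0 = "subvector_algebra (C \<inter> B')"] gen)
         (simp_all add: subalgebra_def subvector_algebra_mono)
  qed
qed

text \<open>
  The residual \<open>y \<bullet> X\<close> depends on \<open>X\<^sub>v\<close> and \<open>X\<^sub>C\<close> only and is independent of \<open>X\<^sub>C\<close>, so given \<open>X\<^sub>C\<close> it
  has mean \<open>0\<close> whatever \<open>X\<^sub>u\<close> is.
\<close>

lemma cond_indep_imp_orthogonal_residual: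
  assumes ci: "cond_indep_subvectors M X A B C" and "u \<in> A" "v \<in> B"
    and supp: "\<And>w. w \<notin> insert v C \<Longrightarrow> y $ w = 0"
    and orth: "\<And>c. c \<in> C \<Longrightarrow> cov (axis c 1) y = 0"
  shows "cov (axis u 1) y = 0"
proof -
  have y_sum: "centred y \<omega> = (\<Sum>w\<in>insert v C. y $ w * (X \<omega> $ w - \<mu> $ w))" for \<omega>
    unfolding centred_def inner_vec_def
    using supp by (intro sum.mono_neutral_cong_right) auto
  have "expectation (\<lambda>\<omega>. centred (axis u 1) \<omega> * centred y \<omega>) = 0"
  proof (rule cond_indep_imp_uncorrelated[of "subvector_algebra C" "subvector_algebra A" "subvector_algebra B"])
    show "centred y \<in> borel_measurable (sigma (space M)
        {L \<inter> Q |L Q. L \<in> sets (subvector_algebra B) \<and> Q \<in> sets (subvector_algebra C)})"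
      unfolding y_sum[abs_def] using \<open>v \<in> B\<close>
      by (intro borel_measurable_sum borel_measurable_times borel_measurable_diff
            borel_measurable_const coordinate_joint_algebra) auto
    show "centred (axis u 1) \<in> borel_measurable (subvector_algebra A)"
      using borel_measurable_diff[OF coordinate_subvector_algebra[OF \<open>u \<in> A\<close>] borel_measurable_const[of "\<mu> $ u"]]
      by (simp add: coordinate_eq_centred)
    show "indep_var borel (centred y) borel f" if "f \<in> borel_measurable (subvector_algebra C)" for f
      using residual_indep_subvector[OF orth] that by (simp add: subvector_algebra_def)
  qed (use ci in \<open>auto simp: cond_indep_subvectors_iff subalgebra_subvector_algebra
        centred_integrable centred_expectation centred_mult_integrable\<close>)
  then show ?thesis by (simp add: centred_mult_expectation)
qed

lemma cond_indep_imp_separates: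
  assumes uniq: "unique_paths (covariance_graph M X)" and "disjnt A B"
    and ci: "cond_indep_subvectors M X A B (UNIV - (A \<union> B \<union> S))"
  shows "separates UNIV (covariance_graph M X) S A B"
proof (rule ccontr)
  define C where "C = UNIV - (A \<union> B \<union> S)"
  assume nsep: "\<not> separates UNIV (covariance_graph M X) S A B"
  then obtain u v p where uv: "u \<in> A" "v \<in> B" and p: "path_between UNIV (covariance_graph M X) u v p"
    and set_p: "set p \<subseteq> insert u (insert v C)"
    using not_separates_connecting_path[OF nsep \<open>disjnt A B\<close>]
    unfolding C_def Compl_eq_Diff_UNIV by blast
  have "v \<notin> C" "u \<notin> insert v C" using uv \<open>disjnt A B\<close> by (auto simp: C_def disjnt_def)
  obtain y where y: "y $ v = 1" "\<And>w. w \<notin> insert v C \<Longrightarrow> y $ w = 0"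
    "\<And>c. c \<in> C \<Longrightarrow> cov (axis c 1) y = 0"
    using residual_on_coordinates[OF \<open>v \<notin> C\<close>] by blast
  have "cov (axis u 1) y = 0"
    using cond_indep_imp_orthogonal_residual[OF ci[folded C_def] uv y(2,3)] .
  then have "y $ v = 0"
    using y set_p \<open>u \<notin> insert v C\<close>
    by (intro tree_path_vanish[OF covariance_graph_eq uniq p]) auto
  then show False using y(1) by simp
qed

end

theorem theorem3:
  fixes M :: "'a measure" and X :: "'a \<Rightarrow> real ^ 'v"
    and \<mu> :: "real ^ 'v" and \<Sigma> :: "real ^ 'v ^ 'v"
  assumes "prob_space M"
    and "transpose \<Sigma> = \<Sigma>" and "positive_definite \<Sigma>"
    and "distributed M lborel X (\<lambda>x. ennreal (mv_normal_density \<mu> \<Sigma> x))"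
    and "is_tree UNIV (covariance_graph M X) \<or> is_union_of_trees UNIV (covariance_graph M X)"
  shows "covariance_faithful M X (covariance_graph M X)"
proof -
  interpret gaussian_vector M X \<mu> \<Sigma>
    using assms by (simp add: gaussian_vector_def covariance_matrix_def gaussian_vector_axioms_def)
  show ?thesis
    unfolding covariance_faithful_def
    using separates_imp_cond_indep cond_indep_imp_separates[OF forest_unique_paths[OF assms(5)]]
    by blast
qed

end
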